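(* Let $A,B$ be finite-dimensional quantum systems and let $U$ be a unitary operator on $\mathcal{H}_A\otimes\mathcal{H}_B$ that has an operator Schmidt decomposition $$U=\sum_j u_j\, L_j\otimes R_j$$ such that all $L_j$ are unitary operators on $\mathcal{H}_A$ and all $R_j$ are unitary operators on $\mathcal{H}_B$. Then the channel $\mathcal{U}(\rho)=U\rho U^\dagger$ satisfies $$\gamma_{\mathrm{LOCC}^\star(A;B)}(\mathcal{U})=\gamma_{\mathrm{LO}^\star(A;B)}(\mathcal{U})=2\Big(\sum_j u_j\Big)^2-1 .$$
   Context: All Hilbert spaces are finite-dimensional. An operator Schmidt decomposition of an operator $X$ on $\mathcal{H}_A\otimes\mathcal{H}_B$ is $X=\sum_j u_j A_j\otimes B_j$ with $u_j>0$ and $(A_j)_j$, $(B_j)_j$ orthonormal families for the normalized Hilbert-Schmidt inner product $\langle O_1,O_2\rangle=\frac{1}{\dim}\mathrm{tr}[O_1^\dagger O_2]$. $\mathrm{HP}(A\to B)$ is the real vector space of Hermitian-preserving linear maps from operators on $\mathcal H_A$ to operators on $\mathcal H_B$; CP, TP, CPTP mean completely positive, trace-preserving, and both. Quasiprobability extent: for $S\subset \mathrm{HP}(A\to B)$ and $\mathcal{E}\in\mathrm{HP}(A\to B)$, $\gamma_S(\mathcal{E})=\inf\{\sum_{i=1}^m|a_i| : m\ge 1,\ \mathcal{E}=\sum_{i=1}^m a_i\mathcal{F}_i,\ \mathcal{F}_i\in S,\ a_i\in\mathbb{R}\}$ ($=\infty$ if no decomposition exists). A quantum instrument from $A$ to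 $B$ is a countable family $(\mathcal{E}_i)_i$ of non-zero CP maps whose sum is TP. For a set $Q$ of instruments, let $Q^{*}:=\{\sum_i\beta_i\mathcal{E}_i : (\mathcal{E}_i)_i\in Q,\ \beta_i\in[-1,1]\}$. $\mathrm{LO}^\star(A;B)$ is $Q^*$ for $Q$ the set of all instruments of the form $(\mathcal{E}_i\otimes\mathcal{F}_j)_{i,j}$, where $(\mathcal{E}_i)_i$ is an instrument from $A$ to $A$ and $(\mathcal{F}_j)_j$ an instrument from $B$ to $B$. $\mathrm{LOCC}^\star(A;B)$ is $Q^*$ for $Q$ the set of all LOCC (local operations and classical communication, unboundedly many rounds) instruments from $AB$ to $AB$, in the standard sense: a one-way local instrument w.r.t. one party is an instrument in which that party applies an arbitrary local instrument and, conditioned on its outcome, the other party applies a CPTP map; an instrument is LOCC-linked to $(\mathcal{I}_j)_j$ if it is a coarse-graining (merging of outcomes) of $(\mathcal{J}_{j'|j}\circ\mathcal{I}_j)_{j,j'}$ where for each $j$, $(\mathcal{J}_{j'|j})_{j'}$ is a one-way local instrument w.r.t. some party (possibly depending on $j$); one-round LOCC instruments are coarse-grainings of one-way local instruments, $r$-round ones are those LOCC-linked to an $(r-1)$-round one; an instrument $\mathcal I$ is LOCC if there is a sequence $\mathcal{I}_1,\mathcal{I}_2,\dots$ with $\mathcal{I}_n$ an $n$-round LOCC instrument that is LOCC-linked to $\mathcal{I}_{n-1}$, such that suitable coarse-grainings of $\mathcal{I}_n$ converge to $\mathcal{I}$. *)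

theory Defs
  imports "HOL-Analysis.Analysis"
begin

section \<open>Operators\<close>

text \<open>
  A finite-dimensional Hilbert space is $\mathbb{C}^{n}$ for a finite index type, and operators on it
  are square matrices. The tensor product of the spaces with index types \<open>'a\<close> and \<open>'b\<close> is the
  space with index type \<open>'a \<times> 'b\<close>.
\<close>

type_synonym 'n operator = "complex^'n^'n"
type_synonym ('n, 'm) superop = "complex^'n^'n \<Rightarrow> complex^'m^'m"

definition dagger :: "'n::finite operator \<Rightarrow> 'n operator" where
  "dagger A = map_matrix cnj (transpose A)"

definition unitary_op :: "'n::finite operator \<Rightarrow> bool" where
  "unitary_op U \<longleftrightarrow> dagger U ** U = mat 1 \<and> U ** dagger U = mat 1"

definition tensor_op :: "'a::finite operator \<Rightarrow> 'b::finite operator \<Rightarrow> ('a \<times> 'b) operator" where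
  "tensor_op A B = (\<chi> p q. A $ fst p $ fst q * B $ snd p $ snd q)"

definition hs_inner :: "'n::finite operator \<Rightarrow> 'n operator \<Rightarrow> complex" where
  "hs_inner A B = trace (dagger A ** B) / of_nat CARD('n)"

definition hs_orthonormal :: "nat \<Rightarrow> (nat \<Rightarrow> 'n::finite operator) \<Rightarrow> bool" where
  "hs_orthonormal m A \<longleftrightarrow> (\<forall>i<m. \<forall>j<m. hs_inner (A i) (A j) = (if i = j then 1 else 0))"

text \<open>The decomposition has \<open>m\<close> terms, indexed by \<open>j < m\<close>.\<close>

definition operator_schmidt_decomp ::
  "('a::finite \<times> 'b::finite) operator \<Rightarrow> nat \<Rightarrow> (nat \<Rightarrow> real) \<Rightarrow> (nat \<Rightarrow> 'a operator) \<Rightarrow>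
     (nat \<Rightarrow> 'b operator) \<Rightarrow> bool" where
  "operator_schmidt_decomp X m u A B \<longleftrightarrow>
     (\<forall>j<m. u j > 0) \<and> hs_orthonormal m A \<and> hs_orthonormal m B \<and>
     X = (\<Sum>j<m. u j *\<^sub>R tensor_op (A j) (B j))"


section \<open>Linear maps between operator spaces\<close>

definition cscale :: "complex \<Rightarrow> 'n::finite operator \<Rightarrow> 'n operator" where
  "cscale c A = map_matrix ((*) c) A"

abbreviation clinear :: "('n::finite, 'm::finite) superop \<Rightarrow> bool" where
  "clinear \<equiv> Vector_Spaces.linear cscale cscale"

lemma vector_space_cscale: "vector_space cscale"
  by unfold_locales (simp_all add: cscale_def map_matrix_def vec_eq_iff algebra_simps)

lemma clinear_iff:
  "clinear f \<longleftrightarrow> (\<forall>X Y. f (X + Y) = f X + f Y) \<and> (\<forall>c X. f (cscale c X) = cscale c (f X))"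
  by (simp add: Vector_Spaces.linear_iff vector_space_cscale)

text \<open>
  \<open>block_psd n X\<close> says that the block matrix $(X_{ij})_{i,j<n}$, that is, the operator
  $\sum_{i,j} |i\rangle\langle j| \otimes X_{ij}$ on $\mathbb{C}^n \otimes \mathcal{H}$, is positive
  semidefinite: its quadratic form at every vector $\sum_i |i\rangle \otimes v_i$ is a nonnegative
  real. The map $\mathrm{id}_n \otimes \mathcal{E}$ acts on such a block matrix entrywise, so
  \<open>completely_positive\<close> is positivity of $\mathrm{id}_n \otimes \mathcal{E}$ for all \<open>n\<close>.
\<close>

definition block_psd :: "nat \<Rightarrow> (nat \<Rightarrow> nat \<Rightarrow> 'n::finite operator) \<Rightarrow> bool" where
  "block_psd n X \<longleftrightarrow> (\<forall>v :: nat \<Rightarrow> complex^'n.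
     (\<Sum>i<n. \<Sum>j<n. \<Sum>k\<in>UNIV. cnj (v i $ k) * (X i j *v v j) $ k) \<in> \<real>\<^sub>\<ge>\<^sub>0)"

definition completely_positive :: "('n::finite, 'm::finite) superop \<Rightarrow> bool" where
  "completely_positive E \<longleftrightarrow> clinear E \<and>
     (\<forall>n X. block_psd n X \<longrightarrow> block_psd n (\<lambda>i j. E (X i j)))"

definition trace_preserving :: "('n::finite, 'm::finite) superop \<Rightarrow> bool" where
  "trace_preserving E \<longleftrightarrow> clinear E \<and> (\<forall>X. trace (E X) = trace X)"

definition cptp :: "('n::finite, 'm::finite) superop \<Rightarrow> bool" where
  "cptp E \<longleftrightarrow> completely_positive E \<and> trace_preserving E"

definition matrix_unit :: "'n::finite \<Rightarrow> 'n \<Rightarrow> 'n operator" where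
  "matrix_unit i j = (\<chi> k l. if k = i \<and> l = j then 1 else 0)"

text \<open>
  The tensor product of linear maps is defined through the expansion
  $X = \sum X_{(i,k),(j,l)}\, |i\rangle\langle j| \otimes |k\rangle\langle l|$.
\<close>

definition tensor_map ::
  "('a::finite, 'c::finite) superop \<Rightarrow> ('b::finite, 'd::finite) superop \<Rightarrow> ('a \<times> 'b, 'c \<times> 'd) superop"
  where
  "tensor_map E F = (\<lambda>X. \<Sum>i\<in>UNIV. \<Sum>j\<in>UNIV. \<Sum>k\<in>UNIV. \<Sum>l\<in>UNIV.
     cscale (X $ (i, k) $ (j, l)) (tensor_op (E (matrix_unit i j)) (F (matrix_unit k l))))"

lemma clinear_expand:
  assumes "clinear E"
  shows "E X = (\<Sum>i\<in>UNIV. \<Sum>j\<in>UNIV. cscale (X $ i $ j) (E (matrix_unit i j)))"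
proof -
  interpret Vector_Spaces.linear cscale cscale E by fact
  have "X = (\<Sum>i\<in>UNIV. \<Sum>j\<in>UNIV. cscale (X $ i $ j) (matrix_unit i j))"
  proof -
    have "(\<Sum>i\<in>UNIV. \<Sum>j\<in>UNIV. X $ i $ j * (if k = i \<and> l = j then 1 else 0)) = X $ k $ l" for k l
    proof -
      have "(\<Sum>i\<in>UNIV. \<Sum>j\<in>UNIV. X $ i $ j * (if k = i \<and> l = j then 1 else 0))
          = (\<Sum>i\<in>UNIV. if k = i then (\<Sum>j\<in>UNIV. if l = j then X $ i $ j else 0) else 0)"
        by (intro sum.cong refl) (auto simp: if_distrib cong: if_cong)
      then show ?thesis by simp
    qed
    then show ?thesis
      by (simp add: vec_eq_iff cscale_def map_matrix_def matrix_unit_def)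
  qed
  then have "E X = E (\<Sum>i\<in>UNIV. \<Sum>j\<in>UNIV. cscale (X $ i $ j) (matrix_unit i j))"
    by (rule arg_cong)
  also have "\<dots> = (\<Sum>i\<in>UNIV. \<Sum>j\<in>UNIV. cscale (X $ i $ j) (E (matrix_unit i j)))"
    by (simp add: sum scale)
  finally show ?thesis .
qed

lemma tensor_map_tensor_op:
  fixes E :: "('a::finite, 'c::finite) superop" and F :: "('b::finite, 'd::finite) superop"
  assumes "clinear E" "clinear F"
  shows "tensor_map E F (tensor_op X Y) = tensor_op (E X) (F Y)"
proof -
  have sum_left: "tensor_op (\<Sum>i\<in>I. f i) B = (\<Sum>i\<in>I. tensor_op (f i) B)"
    for I and f :: "'e \<Rightarrow> 'c operator" and B :: "'d operator"
    by (simp add: tensor_op_def vec_eq_iff sum_distrib_right)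
  have sum_right: "tensor_op A (\<Sum>i\<in>I. f i) = (\<Sum>i\<in>I. tensor_op A (f i))"
    for I and f :: "'e \<Rightarrow> 'd operator" and A :: "'c operator"
    by (simp add: tensor_op_def vec_eq_iff sum_distrib_left)
  have scale: "tensor_op (cscale a A) (cscale b B) = cscale (a * b) (tensor_op A B)"
    for a b and A :: "'c operator" and B :: "'d operator"
    by (simp add: tensor_op_def cscale_def map_matrix_def vec_eq_iff mult_ac)
  show ?thesis
    unfolding clinear_expand[OF assms(1), of X] clinear_expand[OF assms(2), of Y]
    unfolding sum_left unfolding sum_right scale
    by (simp add: tensor_map_def tensor_op_def)
qed

lemma clinear_tensor_map:
  fixes E :: "('a::finite, 'c::finite) superop" and F :: "('b::finite, 'd::finite) superop"
  shows "clinear (tensor_map E F)"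
proof -
  have add: "cscale (a + b) A = cscale a A + cscale b A"
    and mult: "cscale (a * b) A = cscale a (cscale b A)" for a b and A :: "('c \<times> 'd) operator"
    by (simp_all add: cscale_def map_matrix_def vec_eq_iff algebra_simps)
  have sum: "cscale a (\<Sum>i\<in>I. f i) = (\<Sum>i\<in>I. cscale a (f i))"
    for a I and f :: "'e \<Rightarrow> ('c \<times> 'd) operator"
    by (simp add: cscale_def map_matrix_def vec_eq_iff sum_distrib_left)
  have entry: "cscale a X $ p $ q = a * X $ p $ q" for a p q and X :: "('a \<times> 'b) operator"
    by (simp add: cscale_def map_matrix_def)
  show ?thesis
    unfolding clinear_iff
    by (simp add: tensor_map_def add mult sum entry sum.distrib)
qed

definition unitary_channel :: "'n::finite operator \<Rightarrow> ('n, 'n) superop" where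
  "unitary_channel U = (\<lambda>X. U ** X ** dagger U)"


section \<open>Quasiprobability extent\<close>

text \<open>In \<^typ>\<open>ereal\<close>, the infimum of the empty set is \<open>\<infinity>\<close>.\<close>

definition qp_extent ::
  "('n::finite, 'm::finite) superop set \<Rightarrow> ('n, 'm) superop \<Rightarrow> ereal" where
  "qp_extent S E = Inf {ereal (\<Sum>i<k. \<bar>a i\<bar>) | (k::nat) a F.
     k \<ge> 1 \<and> (\<forall>i<k. F i \<in> S) \<and> E = (\<lambda>X. \<Sum>i<k. a i *\<^sub>R F i X)}"


section \<open>Quantum instruments\<close>

text \<open>
  A family of non-zero CP maps indexed by a subset \<open>I\<close> of a countable type is encoded by the total
  function on that type which is the zero map outside \<open>I\<close>. The index set \<open>I\<close> is thus the support
  of the function, a label carrying the zero map is an unused label, and outcomes that become zero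
  under composition disappear from the family. Taking all countable families of
  non-zero maps amounts to taking \<open>nat\<close> (or \<open>nat \<times> nat\<close>) as label type.
\<close>

type_synonym ('i, 'n, 'm) family = "'i \<Rightarrow> complex^'n^'n \<Rightarrow> complex^'m^'m"

definition instrument :: "('i::countable, 'n::finite, 'm::finite) family \<Rightarrow> bool" where
  "instrument E \<longleftrightarrow> (\<forall>i. completely_positive (E i)) \<and>
     (\<exists>T. (\<forall>X. ((\<lambda>i. E i X) has_sum T X) UNIV) \<and> trace_preserving T)"

definition Qstar :: "('i::countable, 'n::finite, 'm::finite) family set \<Rightarrow> ('n, 'm) superop set" where
  "Qstar Q = {F. \<exists>E\<in>Q. \<exists>\<beta>. (\<forall>i. \<beta> i \<in> {-1..1::real}) \<and>
     (\<forall>X. ((\<lambda>i. \<beta> i *\<^sub>R E i X) has_sum F X) UNIV)}"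

text \<open>The outcomes of \<open>E\<close> are relabelled by \<open>g\<close>, and outcomes with the same new label are merged.\<close>

definition coarse_graining ::
  "('i::countable, 'n::finite, 'm::finite) family \<Rightarrow> ('k::countable, 'n, 'm) family \<Rightarrow> bool" where
  "coarse_graining E F \<longleftrightarrow> (\<exists>g. \<forall>k X. ((\<lambda>i. E i X) has_sum F k X) {i. g i = k})"


section \<open>Local operations\<close>

definition LO_instruments :: "(nat \<times> nat, 'a::finite \<times> 'b::finite, 'a \<times> 'b) family set" where
  "LO_instruments = {(\<lambda>(i, j). tensor_map (E i) (F j)) | (E :: (nat, 'a, 'a) family)
      (F :: (nat, 'b, 'b) family). instrument E \<and> instrument F}"

definition LO_star :: "('a::finite \<times> 'b::finite, 'a \<times> 'b) superop set" where
  "LO_star = Qstar LO_instruments"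


section \<open>Local operations and classical communication\<close>

definition one_way_local_A :: "(nat, 'a::finite \<times> 'b::finite, 'a \<times> 'b) family \<Rightarrow> bool" where
  "one_way_local_A J \<longleftrightarrow> (\<exists>(E :: (nat, 'a, 'a) family) (F :: (nat, 'b, 'b) family).
     instrument E \<and> (\<forall>i. cptp (F i)) \<and> J = (\<lambda>i. tensor_map (E i) (F i)))"

definition one_way_local_B :: "(nat, 'a::finite \<times> 'b::finite, 'a \<times> 'b) family \<Rightarrow> bool" where
  "one_way_local_B J \<longleftrightarrow> (\<exists>(E :: (nat, 'a, 'a) family) (F :: (nat, 'b, 'b) family).
     (\<forall>i. cptp (E i)) \<and> instrument F \<and> J = (\<lambda>i. tensor_map (E i) (F i)))"

definition one_way_local :: "(nat, 'a::finite \<times> 'b::finite, 'a \<times> 'b) family \<Rightarrow> bool" where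
  "one_way_local J \<longleftrightarrow> one_way_local_A J \<or> one_way_local_B J"

text \<open>\<open>LOCC_linked I' I\<close>: the instrument \<open>I'\<close> is LOCC-linked to \<open>I\<close>.\<close>

definition LOCC_linked ::
  "(nat, 'a::finite \<times> 'b::finite, 'a \<times> 'b) family \<Rightarrow> (nat, 'a \<times> 'b, 'a \<times> 'b) family \<Rightarrow> bool" where
  "LOCC_linked I' I \<longleftrightarrow> (\<exists>J :: nat \<Rightarrow> (nat, 'a \<times> 'b, 'a \<times> 'b) family.
     (\<forall>j. one_way_local (J j)) \<and> coarse_graining (\<lambda>(j, j'). J j j' \<circ> I j) I')"

inductive LOCC_round :: "nat \<Rightarrow> (nat, 'a::finite \<times> 'b::finite, 'a \<times> 'b) family \<Rightarrow> bool" where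
  one: "one_way_local E \<Longrightarrow> coarse_graining E F \<Longrightarrow> LOCC_round 1 F"
| step: "LOCC_round r E \<Longrightarrow> LOCC_linked F E \<Longrightarrow> LOCC_round (Suc r) F"

text \<open>
  Convergence of instruments is convergence of the associated quantum-classical maps
  $\rho \mapsto \sum_i \mathcal{E}_i(\rho) \otimes |i\rangle\langle i|$. By equivalence of norms in
  finite dimension, the $\ell^1$-sum of operator norms below induces the same topology as the
  diamond norm of that map.
\<close>

definition instruments_converge ::
  "(nat \<Rightarrow> (nat, 'n::finite, 'm::finite) family) \<Rightarrow> (nat, 'n, 'm) family \<Rightarrow> bool" where
  "instruments_converge J I \<longleftrightarrow>
     (\<lambda>n. \<Sum>i. ennreal (onorm (\<lambda>X. J n i X - I i X))) \<longlonglongrightarrow> 0"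

definition LOCC_instrument :: "(nat, 'a::finite \<times> 'b::finite, 'a \<times> 'b) family \<Rightarrow> bool" where
  "LOCC_instrument I \<longleftrightarrow> instrument I \<and>
     (\<exists>J J'. (\<forall>n\<ge>1. LOCC_round n (J n)) \<and> (\<forall>n\<ge>2. LOCC_linked (J n) (J (n - 1))) \<and>
       (\<forall>n\<ge>1. coarse_graining (J n) (J' n)) \<and> instruments_converge J' I)"

definition LOCC_star :: "('a::finite \<times> 'b::finite, 'a \<times> 'b) superop set" where
  "LOCC_star = Qstar {I. LOCC_instrument I}"

end

theory Submission
  imports Defs
begin

text \<open>
  Lower bound: put $V = \sum_j L_j \otimes R_j$. The overlap of the Choi operator of a map with the
  vector of $V$, suitably normalised, is $(\sum_j u_j)^2$ for the channel of $U$ and lies between $0$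
  and the normalised trace of the Choi operator for every tensor product of CP maps. These two
  bounds, required also after composition with arbitrary product CP maps, survive composition with
  local maps, coarse-graining and limits, hence hold for all elements of LOCC instruments. So twice
  the overlap minus the trace is at most $1$ in absolute value on LOCC${}^\star$, and equals
  $2 (\sum_j u_j)^2 - 1$ on the channel of $U$.

  Upper bound: expand $U X U^\dagger$ in the Schmidt decomposition. The term of a pair $(j,k)$ plus
  its adjoint is twice a difference of two products of local maps, the Hermitian-preserving real and
  imaginary parts of $X \mapsto L_j X L_k^\dagger$ and $X \mapsto R_j X R_k^\dagger$, and each of
  these parts is the difference of the two outcomes of an instrument.
\<close>

section \<open>Operators and linear maps\<close>

text \<open>Complete positivity alone cannot bound the overlap by the trace: the channel of
  \<open>U\<close> violates that bound as soon as \<open>m > 1\<close>, since then (sum u_j)^2 > sum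
  u_j^2 = 1. The bound comes from the product structure, through Gram matrices on both sides. A
  limit of LOCC maps is not given as a sum of products, so the structure is traded for weak linear
  inequalities, which pass to limits.

  The form of the witness is dictated by the coefficients in [-1, 1]: twice the overlap minus the
  trace sends the interval [0, trace] onto [-trace, trace], and such coefficients preserve the
  latter. The traces of the outcomes of an instrument add up to that of a trace-preserving map, a
  constant.

  In the upper bound the summand -1 is minus the sum of the u_j^2, the squared norm of
  \<open>U\<close>: diagonal pairs need one product of local maps where off-diagonal pairs need two.
  Unitarity of the \<open>L j\<close> and \<open>R j\<close> makes the two-outcome local families
  trace-preserving in total.\<close>

lemma cscale_nth [simp]: "cscale c A $ i $ j = c * A $ i $ j"
  by (simp add: cscale_def map_matrix_def)

lemma dagger_nth [simp]: "dagger A $ i $ j = cnj (A $ j $ i)"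
  by (simp add: dagger_def map_matrix_def transpose_def)

lemma tensor_op_nth [simp]: "tensor_op A B $ p $ q = A $ fst p $ fst q * B $ snd p $ snd q"
  by (simp add: tensor_op_def)

lemma matrix_unit_nth: "matrix_unit i j $ k $ l = (if k = i \<and> l = j then 1 else 0)"
  by (simp add: matrix_unit_def)

lemma matrix_mult_nth: "(A ** B) $ i $ j = (\<Sum>k\<in>UNIV. A $ i $ k * B $ k $ j)"
  by (simp add: matrix_matrix_mult_def)

lemma scaleR_eq_cscale: "r *\<^sub>R A = cscale (of_real r) A"
  by (simp add: vec_eq_iff) (simp add: scaleR_conv_of_real)

lemma cscale_sum: "cscale c (\<Sum>i\<in>I. f i) = (\<Sum>i\<in>I. cscale c (f i))"
  by (simp add: vec_eq_iff sum_distrib_left)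

lemma cscale_add_right: "cscale c (A + B) = cscale c A + cscale c B"
  by (simp add: vec_eq_iff algebra_simps)

lemma cscale_cscale: "cscale c (cscale d A) = cscale (c * d) A"
  by (simp add: vec_eq_iff)

lemma clinear_add: "clinear f \<Longrightarrow> f (X + Y) = f X + f Y"
  and clinear_cscale: "clinear f \<Longrightarrow> f (cscale c X) = cscale c (f X)"
  by (auto simp: clinear_iff)

lemma clinear_zero: "clinear f \<Longrightarrow> f 0 = 0"
  using clinear_add[of f 0 0] by simp

lemma clinear_scaleR: "clinear f \<Longrightarrow> f (r *\<^sub>R X) = r *\<^sub>R f X"
  by (simp add: scaleR_eq_cscale clinear_cscale)

lemma clinear_sum: "clinear f \<Longrightarrow> f (\<Sum>i\<in>I. g i) = (\<Sum>i\<in>I. f (g i))"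
  by (induction I rule: infinite_finite_induct) (auto simp: clinear_zero clinear_add)

lemma clinear_bounded_linear: "clinear f \<Longrightarrow> bounded_linear f"
  unfolding linear_conv_bounded_linear [symmetric]
  by (intro linearI) (auto simp: clinear_add clinear_scaleR)

lemma clinear_compose: "clinear f \<Longrightarrow> clinear g \<Longrightarrow> clinear (f \<circ> g)"
  by (simp add: clinear_iff)

lemma clinear_id: "clinear (\<lambda>X. X)"
  by (simp add: clinear_iff)

lemma clinear_null: "clinear (\<lambda>X. 0)"
  by (simp add: clinear_iff vec_eq_iff)

lemma clinear_sum_fun: "(\<And>i. i \<in> I \<Longrightarrow> clinear (F i)) \<Longrightarrow> clinear (\<lambda>X. \<Sum>i\<in>I. F i X)"
  by (simp add: clinear_iff sum.distrib cscale_sum)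

lemma clinear_sandwich: "clinear (\<lambda>X. A ** X ** B)"
  by (simp add: clinear_iff vec_eq_iff matrix_mult_nth sum_distrib_left sum_distrib_right
      algebra_simps sum.distrib)

lemma matrix_unit_pair: "matrix_unit (a, b) (c, d) = tensor_op (matrix_unit a c) (matrix_unit b d)"
  by (auto simp: vec_eq_iff matrix_unit_nth)

text \<open>Matrix units of the composite space are tensor products of matrix units, so product
  operators determine a linear map. Identities between maps on the composite system are checked this
  way.\<close>

lemma clinear_eqI_tensor:
  fixes f g :: "('a::finite \<times> 'b::finite, 'm::finite) superop"
  assumes "clinear f" "clinear g" "\<And>X Y. f (tensor_op X Y) = g (tensor_op X Y)"
  shows "f = g"
proof
  fix X
  have "f (matrix_unit p q) = g (matrix_unit p q)" for p q
    by (cases p, cases q) (simp add: matrix_unit_pair assms(3))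
  then show "f X = g X"
    by (simp add: clinear_expand[OF assms(1), of X] clinear_expand[OF assms(2), of X])
qed

lemma tensor_map_compose:
  assumes "clinear E" "clinear F" "clinear E'" "clinear F'"
  shows "tensor_map E F \<circ> tensor_map E' F' = tensor_map (E \<circ> E') (F \<circ> F')"
  by (rule clinear_eqI_tensor)
    (simp_all add: clinear_compose clinear_tensor_map tensor_map_tensor_op assms)

lemma tensor_map_id: "tensor_map (\<lambda>X. X) (\<lambda>X. X) = (\<lambda>X. X)"
  by (rule clinear_eqI_tensor)
    (simp_all add: clinear_id clinear_tensor_map tensor_map_tensor_op)

lemma tensor_map_null: "tensor_map (\<lambda>X. 0) F = (\<lambda>X. 0)" "tensor_map E (\<lambda>X. 0) = (\<lambda>X. 0)"
  by (simp_all add: tensor_map_def fun_eq_iff vec_eq_iff)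

lemma tensor_op_mult: "tensor_op A B ** tensor_op C D = tensor_op (A ** C) (B ** D)"
  by (simp add: vec_eq_iff matrix_mult_nth sum_product sum.cartesian_product UNIV_Times_UNIV
      [symmetric] case_prod_beta mult_ac del: UNIV_Times_UNIV)

lemma dagger_tensor_op: "dagger (tensor_op A B) = tensor_op (dagger A) (dagger B)"
  by (simp add: vec_eq_iff)

lemma trace_tensor_op: "trace (tensor_op A B) = trace A * trace B"
  by (simp add: trace_def sum_product sum.cartesian_product UNIV_Times_UNIV
      [symmetric] case_prod_beta del: UNIV_Times_UNIV)

lemma trace_sum: "trace (\<Sum>i\<in>I. A i) = (\<Sum>i\<in>I. trace (A i))"
  by (simp add: trace_def sum.swap[of _ I])

lemma trace_cscale: "trace (cscale c A) = c * trace A"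
  by (simp add: trace_def sum_distrib_left)

lemma trace_matrix_unit: "trace (matrix_unit i j) = (if i = j then 1 else 0)"
  by (auto simp: trace_def matrix_unit_nth intro: sum.neutral)

section \<open>Completely positive maps\<close>

text \<open>Complete positivity is defined with blocks indexed by \<open>i < n\<close>. Below,
  blocks are also indexed by pairs (slices along a tensor factor) and by basis labels (Choi
  matrices), hence a version over arbitrary index sets.\<close>

definition psd_on :: "'i set \<Rightarrow> ('i \<Rightarrow> 'i \<Rightarrow> 'n::finite operator) \<Rightarrow> bool" where
  "psd_on I X \<longleftrightarrow> (\<forall>v :: 'i \<Rightarrow> complex^'n.
     (\<Sum>i\<in>I. \<Sum>j\<in>I. \<Sum>k\<in>UNIV. \<Sum>l\<in>UNIV. cnj (v i $ k) * X i j $ k $ l * v j $ l) \<in> \<real>\<^sub>\<ge>\<^sub>0)"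

lemma block_psd_iff: "block_psd n X \<longleftrightarrow> psd_on {..<n} X"
  by (simp add: block_psd_def psd_on_def matrix_vector_mult_def sum_distrib_left mult.assoc)

lemma psd_on_reindex:
  assumes "bij_betw h J I"
  shows "psd_on J (\<lambda>i j. X (h i) (h j)) \<longleftrightarrow> psd_on I X"
proof -
  have inv: "bij_betw (inv_into J h) I J" by (rule bij_betw_inv_into[OF assms])
  have *: "(\<Sum>i\<in>J. \<Sum>j\<in>J. \<Sum>k\<in>UNIV. \<Sum>l\<in>UNIV. cnj (v (h i) $ k) * X (h i) (h j) $ k $ l * v (h j) $ l)
     = (\<Sum>i\<in>I. \<Sum>j\<in>I. \<Sum>k\<in>UNIV. \<Sum>l\<in>UNIV. cnj (v i $ k) * X i j $ k $ l * v j $ l)" for v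
  proof -
    have "(\<Sum>j\<in>J. \<Sum>k\<in>UNIV. \<Sum>l\<in>UNIV. cnj (v a $ k) * X a (h j) $ k $ l * v (h j) $ l)
     = (\<Sum>j\<in>I. \<Sum>k\<in>UNIV. \<Sum>l\<in>UNIV. cnj (v a $ k) * X a j $ k $ l * v j $ l)" for a
      by (rule sum.reindex_bij_betw[OF assms])
    then show ?thesis
      using sum.reindex_bij_betw[OF assms, of "\<lambda>i. \<Sum>j\<in>I. \<Sum>k\<in>UNIV. \<Sum>l\<in>UNIV. cnj (v i $ k) * X i j $ k $ l * v j $ l"]
      by simp
  qed
  show ?thesis
  proof
    assume L: "psd_on J (\<lambda>i j. X (h i) (h j))"
    show "psd_on I X"
      unfolding psd_on_def
    proof
      fix v
      show "(\<Sum>i\<in>I. \<Sum>j\<in>I. \<Sum>k\<in>UNIV. \<Sum>l\<in>UNIV. cnj (v i $ k) * X i j $ k $ l * v j $ l) \<in> \<real>\<^sub>\<ge>\<^sub>0"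
        using L[unfolded psd_on_def, rule_format, of "\<lambda>i. v (h i)"] * by simp
    qed
  next
    assume R: "psd_on I X"
    show "psd_on J (\<lambda>i j. X (h i) (h j))"
      unfolding psd_on_def
    proof
      fix v
      have "inv_into J h (h i) = i" if "i \<in> J" for i
        using that assms by (simp add: bij_betw_def)
      then show "(\<Sum>i\<in>J. \<Sum>j\<in>J. \<Sum>k\<in>UNIV. \<Sum>l\<in>UNIV. cnj (v i $ k) * X (h i) (h j) $ k $ l * v j $ l) \<in> \<real>\<^sub>\<ge>\<^sub>0"
        using R[unfolded psd_on_def, rule_format, of "\<lambda>i. v (inv_into J h i)"] *[of "\<lambda>i. v (inv_into J h i)"]
        by (simp cong: sum.cong)
    qed
  qed
qed

lemma cp_psd_on:
  assumes "completely_positive E" "finite I" "psd_on I X"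
  shows "psd_on I (\<lambda>i j. E (X i j))"
proof -
  obtain h where h: "bij_betw h {..<card I} I"
    using ex_bij_betw_nat_finite[OF assms(2)] by (auto simp: lessThan_atLeast0)
  have "block_psd (card I) (\<lambda>i j. X (h i) (h j))"
    unfolding block_psd_iff psd_on_reindex[OF h] by fact
  then have "block_psd (card I) (\<lambda>i j. E (X (h i) (h j)))"
    using assms(1) by (auto simp: completely_positive_def)
  then show ?thesis
    unfolding block_psd_iff psd_on_reindex[OF h, of "\<lambda>i j. E (X i j)"] .
qed

lemma cp_clinear: "completely_positive E \<Longrightarrow> clinear E"
  by (simp add: completely_positive_def)

lemma cpI:
  assumes "clinear E" "\<And>n X. psd_on {..<n::nat} X \<Longrightarrow> psd_on {..<n} (\<lambda>i j. E (X i j))"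
  shows "completely_positive E"
  using assms by (auto simp: completely_positive_def block_psd_iff)

lemma cp_compose: "completely_positive E \<Longrightarrow> completely_positive F \<Longrightarrow> completely_positive (E \<circ> F)"
  by (simp add: completely_positive_def clinear_compose)

lemma cp_id: "completely_positive (\<lambda>X. X)"
  by (simp add: completely_positive_def clinear_id)

lemma cp_null: "completely_positive (\<lambda>X. 0)"
  by (simp add: completely_positive_def clinear_null block_psd_iff psd_on_def)

text \<open>The quadratic form of the blocks \<open>K ** X i j ** dagger K\<close> at
  \<open>v\<close> is the form of \<open>X\<close> at the vectors \<open>dagger K *v v i\<close>.
  The chain of sum exchanges only moves the inner indices outward.\<close>

lemma cp_kraus: "completely_positive (\<lambda>X. K ** X ** dagger K)"
proof (rule cpI[OF clinear_sandwich])
  fix n and X :: "nat \<Rightarrow> nat \<Rightarrow> 'a operator"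
  assume X: "psd_on {..<n} X"
  show "psd_on {..<n} (\<lambda>i j. K ** X i j ** dagger K)"
    unfolding psd_on_def
  proof
    fix v :: "nat \<Rightarrow> complex^'a"
    have "(\<Sum>k\<in>UNIV. \<Sum>l\<in>UNIV. cnj (v i $ k) * (K ** X i j ** dagger K) $ k $ l * v j $ l)
      = (\<Sum>k\<in>UNIV. \<Sum>l\<in>UNIV. cnj ((dagger K *v v i) $ k) * X i j $ k $ l * (dagger K *v v j) $ l)" for i j
    proof -
      have "(\<Sum>k\<in>UNIV. \<Sum>l\<in>UNIV. cnj (v i $ k) * (K ** X i j ** dagger K) $ k $ l * v j $ l)
        = (\<Sum>k\<in>UNIV. \<Sum>l\<in>UNIV. \<Sum>b\<in>UNIV. \<Sum>a\<in>UNIV. cnj (v i $ k) * K $ k $ a * X i j $ a $ b * cnj (K $ l $ b) * v j $ l)"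
        by (simp add: matrix_mult_nth sum_distrib_left sum_distrib_right mult_ac)
      also have "\<dots> = (\<Sum>k\<in>UNIV. \<Sum>b\<in>UNIV. \<Sum>l\<in>UNIV. \<Sum>a\<in>UNIV. cnj (v i $ k) * K $ k $ a * X i j $ a $ b * cnj (K $ l $ b) * v j $ l)"
        by (intro sum.cong refl sum.swap)
      also have "\<dots> = (\<Sum>k\<in>UNIV. \<Sum>b\<in>UNIV. \<Sum>a\<in>UNIV. \<Sum>l\<in>UNIV. cnj (v i $ k) * K $ k $ a * X i j $ a $ b * cnj (K $ l $ b) * v j $ l)"
        by (intro sum.cong refl sum.swap)
      also have "\<dots> = (\<Sum>k\<in>UNIV. \<Sum>a\<in>UNIV. \<Sum>b\<in>UNIV. \<Sum>l\<in>UNIV. cnj (v i $ k) * K $ k $ a * X i j $ a $ b * cnj (K $ l $ b) * v j $ l)"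
        by (intro sum.cong refl sum.swap)
      also have "\<dots> = (\<Sum>a\<in>UNIV. \<Sum>k\<in>UNIV. \<Sum>b\<in>UNIV. \<Sum>l\<in>UNIV. cnj (v i $ k) * K $ k $ a * X i j $ a $ b * cnj (K $ l $ b) * v j $ l)"
        by (rule sum.swap)
      also have "\<dots> = (\<Sum>a\<in>UNIV. \<Sum>b\<in>UNIV. \<Sum>k\<in>UNIV. \<Sum>l\<in>UNIV. cnj (v i $ k) * K $ k $ a * X i j $ a $ b * cnj (K $ l $ b) * v j $ l)"
        by (intro sum.cong refl sum.swap)
      also have "\<dots> = (\<Sum>k\<in>UNIV. \<Sum>l\<in>UNIV. cnj ((dagger K *v v i) $ k) * X i j $ k $ l * (dagger K *v v j) $ l)"
        by (simp add: matrix_vector_mult_def sum_distrib_left sum_distrib_right mult_ac)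
      finally show ?thesis .
    qed
    then show "(\<Sum>i<n. \<Sum>j<n. \<Sum>k\<in>UNIV. \<Sum>l\<in>UNIV. cnj (v i $ k) * (K ** X i j ** dagger K) $ k $ l * v j $ l) \<in> \<real>\<^sub>\<ge>\<^sub>0"
      using X by (simp add: psd_on_def)
  qed
qed

lemma sum_UNIV_pair: "(\<Sum>p\<in>UNIV. f p) = (\<Sum>a\<in>UNIV. \<Sum>b\<in>UNIV. f (a, b))"
  for f :: "'a::finite \<times> 'b::finite \<Rightarrow> 'c::comm_monoid_add"
  by (simp add: sum.cartesian_product)

lemma sum_Times: "(\<Sum>p\<in>A \<times> B. f p) = (\<Sum>a\<in>A. \<Sum>b\<in>B. f (a, b))"
  by (simp add: sum.cartesian_product)

text \<open>The index of the second factor can be counted as part of the block index: an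
  \<open>n\<close>-block matrix over the composite space is a block matrix over the first factor
  with labels in \<open>{..<n} \<times> UNIV\<close>, and tensoring \<open>E\<close> with the
  identity acts on it block by block as \<open>E\<close>.\<close>

lemma cp_tensor_id:
  fixes E :: "('a::finite, 'c::finite) superop"
  assumes E: "completely_positive E"
  shows "completely_positive (tensor_map E (\<lambda>Y :: 'b::finite operator. Y))"
proof (rule cpI[OF clinear_tensor_map])
  fix n and X :: "nat \<Rightarrow> nat \<Rightarrow> ('a \<times> 'b) operator"
  assume X: "psd_on {..<n} X"
  define Y :: "nat \<times> 'b \<Rightarrow> nat \<times> 'b \<Rightarrow> 'a operator"
    where "Y s t = (\<chi> a a'. X (fst s) (fst t) $ (a, snd s) $ (a', snd t))" for s t
  \<comment> \<open>The first factor is kept generic because the regrouping serves both the input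
    over \<open>'a\<close> and the output over \<open>'c\<close>.\<close>
  have slice: "(\<Sum>i<n. \<Sum>j<n. \<Sum>k\<in>UNIV. \<Sum>l\<in>UNIV. cnj (v i $ k) * Z i j $ k $ l * v j $ l)
    = (\<Sum>s\<in>{..<n}\<times>UNIV. \<Sum>t\<in>{..<n}\<times>UNIV. \<Sum>a\<in>UNIV. \<Sum>a'\<in>UNIV.
      cnj (v (fst s) $ (a, snd s)) * Z (fst s) (fst t) $ (a, snd s) $ (a', snd t) * v (fst t) $ (a', snd t))"
    for v and Z :: "nat \<Rightarrow> nat \<Rightarrow> ('e::finite \<times> 'b) operator"
  proof -
    define g where "g i j a b a' b' = cnj (v i $ (a, b)) * Z i j $ (a, b) $ (a', b') * v j $ (a', b')" for i j a b a' b'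
    have "(\<Sum>i<n. \<Sum>j<n. \<Sum>k\<in>UNIV. \<Sum>l\<in>UNIV. cnj (v i $ k) * Z i j $ k $ l * v j $ l)
      = (\<Sum>i<n. \<Sum>j<n. \<Sum>a\<in>UNIV. \<Sum>b\<in>UNIV. \<Sum>a'\<in>UNIV. \<Sum>b'\<in>UNIV. g i j a b a' b')"
      by (simp add: g_def sum_UNIV_pair)
    also have "\<dots> = (\<Sum>i<n. \<Sum>j<n. \<Sum>b\<in>UNIV. \<Sum>a\<in>UNIV. \<Sum>a'\<in>UNIV. \<Sum>b'\<in>UNIV. g i j a b a' b')"
      by (intro sum.cong refl, rule sum.swap)
    also have "\<dots> = (\<Sum>i<n. \<Sum>j<n. \<Sum>b\<in>UNIV. \<Sum>a\<in>UNIV. \<Sum>b'\<in>UNIV. \<Sum>a'\<in>UNIV. g i j a b a' b')"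
      by (intro sum.cong refl, rule sum.swap)
    also have "\<dots> = (\<Sum>i<n. \<Sum>b\<in>UNIV. \<Sum>j<n. \<Sum>a\<in>UNIV. \<Sum>b'\<in>UNIV. \<Sum>a'\<in>UNIV. g i j a b a' b')"
      by (intro sum.cong refl, rule sum.swap)
    also have "\<dots> = (\<Sum>i<n. \<Sum>b\<in>UNIV. \<Sum>j<n. \<Sum>b'\<in>UNIV. \<Sum>a\<in>UNIV. \<Sum>a'\<in>UNIV. g i j a b a' b')"
      by (intro sum.cong refl, rule sum.swap)
    also have "\<dots> = (\<Sum>s\<in>{..<n}\<times>UNIV. \<Sum>t\<in>{..<n}\<times>UNIV. \<Sum>a\<in>UNIV. \<Sum>a'\<in>UNIV. g (fst s) (fst t) a (snd s) a' (snd t))"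
      by (simp add: sum_Times)
    finally show ?thesis by (simp add: g_def)
  qed
  have "psd_on ({..<n} \<times> UNIV) Y"
    unfolding psd_on_def
  proof
    fix w :: "nat \<times> 'b \<Rightarrow> complex^'a"
    show "(\<Sum>i\<in>{..<n} \<times> UNIV. \<Sum>j\<in>{..<n} \<times> UNIV. \<Sum>k\<in>UNIV. \<Sum>l\<in>UNIV. cnj (w i $ k) * Y i j $ k $ l * w j $ l) \<in> \<real>\<^sub>\<ge>\<^sub>0"
      using X[unfolded psd_on_def, rule_format, of "\<lambda>i. \<chi> p. w (i, snd p) $ fst p"]
      unfolding slice by (simp add: Y_def)
  qed
  then have EY: "psd_on ({..<n} \<times> UNIV) (\<lambda>s t. E (Y s t))"
    by (rule cp_psd_on[OF E, rotated]) simp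
  have entry: "tensor_map E (\<lambda>Y. Y) (X i j) $ (a, b) $ (a', b') = E (Y (i, b) (j, b')) $ a $ a'" for i j a b a' b'
  proof -
    have "tensor_map E (\<lambda>Y. Y) (X i j) $ (a, b) $ (a', b')
      = (\<Sum>c\<in>UNIV. \<Sum>d\<in>UNIV. \<Sum>k\<in>UNIV. \<Sum>l\<in>UNIV. if k = b then if l = b' then X i j $ (c, k) $ (d, l) * E (matrix_unit c d) $ a $ a' else 0 else 0)"
      unfolding tensor_map_def by (simp add: matrix_unit_nth) (intro sum.cong refl, auto)
    also have "\<dots> = (\<Sum>c\<in>UNIV. \<Sum>d\<in>UNIV. \<Sum>k\<in>UNIV. if k = b then \<Sum>l\<in>UNIV. if l = b' then X i j $ (c, k) $ (d, l) * E (matrix_unit c d) $ a $ a' else 0 else 0)"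
      by (intro sum.cong refl) auto
    also have "\<dots> = (\<Sum>c\<in>UNIV. \<Sum>d\<in>UNIV. X i j $ (c, b) $ (d, b') * E (matrix_unit c d) $ a $ a')"
      by simp
    also have "\<dots> = E (Y (i, b) (j, b')) $ a $ a'"
      by (subst clinear_expand[OF cp_clinear[OF E], of "Y (i, b) (j, b')"]) (simp add: Y_def)
    finally show ?thesis .
  qed
  show "psd_on {..<n} (\<lambda>i j. tensor_map E (\<lambda>Y. Y) (X i j))"
    unfolding psd_on_def
  proof
    fix v :: "nat \<Rightarrow> complex^('c \<times> 'b)"
    show "(\<Sum>i<n. \<Sum>j<n. \<Sum>k\<in>UNIV. \<Sum>l\<in>UNIV. cnj (v i $ k) * tensor_map E (\<lambda>Y. Y) (X i j) $ k $ l * v j $ l) \<in> \<real>\<^sub>\<ge>\<^sub>0"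
      using EY[unfolded psd_on_def, rule_format, of "\<lambda>s. \<chi> a. v (fst s) $ (a, snd s)"]
      unfolding slice by (simp add: entry)
  qed
qed

definition swap_op :: "('a::finite \<times> 'b::finite) operator \<Rightarrow> ('b \<times> 'a) operator" where
  "swap_op X = (\<chi> p q. X $ prod.swap p $ prod.swap q)"

lemma swap_op_nth [simp]: "swap_op X $ p $ q = X $ prod.swap p $ prod.swap q"
  by (simp add: swap_op_def)

lemma sum_swap_pair: "(\<Sum>p\<in>UNIV. f (prod.swap p)) = (\<Sum>p\<in>UNIV. f p)"
  for f :: "'a::finite \<times> 'b::finite \<Rightarrow> complex"
  by (rule sum.reindex_bij_witness[of _ prod.swap prod.swap]) auto

lemma sum_swap_pair2: "(\<Sum>p\<in>UNIV. \<Sum>q\<in>UNIV. f (prod.swap p) (prod.swap q)) = (\<Sum>p\<in>UNIV. \<Sum>q\<in>UNIV. f p q)"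
  for f :: "'a::finite \<times> 'b::finite \<Rightarrow> 'a \<times> 'b \<Rightarrow> complex"
  unfolding sum_swap_pair by (rule sum_swap_pair)

lemma cp_swap_op: "completely_positive (swap_op :: ('a::finite \<times> 'b::finite, 'b \<times> 'a) superop)"
proof (rule cpI)
  show "clinear (swap_op :: ('a \<times> 'b, 'b \<times> 'a) superop)"
    by (simp add: clinear_iff vec_eq_iff)
  fix n and X :: "nat \<Rightarrow> nat \<Rightarrow> ('a \<times> 'b) operator"
  assume X: "psd_on {..<n} X"
  show "psd_on {..<n} (\<lambda>i j. swap_op (X i j))"
    unfolding psd_on_def
  proof
    fix v :: "nat \<Rightarrow> complex^('b \<times> 'a)"
    have "(\<Sum>k\<in>UNIV. \<Sum>l\<in>UNIV. cnj (v i $ k) * swap_op (X i j) $ k $ l * v j $ l)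
        = (\<Sum>k\<in>UNIV. \<Sum>l\<in>UNIV. cnj (v i $ prod.swap k) * X i j $ k $ l * v j $ prod.swap l)" for i j
      using sum_swap_pair2[of "\<lambda>k l. cnj (v i $ prod.swap k) * X i j $ k $ l * v j $ prod.swap l"]
      by simp
    then show "(\<Sum>i<n. \<Sum>j<n. \<Sum>k\<in>UNIV. \<Sum>l\<in>UNIV. cnj (v i $ k) * swap_op (X i j) $ k $ l * v j $ l) \<in> \<real>\<^sub>\<ge>\<^sub>0"
      using X[unfolded psd_on_def, rule_format, of "\<lambda>i. \<chi> p. v i $ prod.swap p"] by simp
  qed
qed

text \<open>Act with \<open>E\<close> on the first factor, exchange the factors, act with
  \<open>F\<close>, exchange back. Each stage is completely positive, and the identity always sits
  on the second factor.\<close>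

lemma cp_tensor_map:
  fixes E :: "('a::finite, 'c::finite) superop" and F :: "('b::finite, 'd::finite) superop"
  assumes "completely_positive E" "completely_positive F"
  shows "completely_positive (tensor_map E F)"
proof -
  have swap: "swap_op (tensor_op X Y) = tensor_op Y X" for X :: "'e::finite operator" and Y :: "'f::finite operator"
    by (simp add: vec_eq_iff)
  have "tensor_map E F =
      swap_op \<circ> tensor_map F (\<lambda>X. X) \<circ> swap_op \<circ> tensor_map E (\<lambda>Y. Y)"
    by (rule clinear_eqI_tensor)
      (simp_all add: clinear_compose clinear_tensor_map tensor_map_tensor_op clinear_id
        cp_clinear cp_swap_op assms swap)
  then show ?thesis
    by (simp add: cp_compose cp_swap_op cp_tensor_id assms)
qed

section \<open>Positive semidefinite forms\<close>

definition sesq :: "('s::finite \<Rightarrow> 's \<Rightarrow> complex) \<Rightarrow> ('s \<Rightarrow> complex) \<Rightarrow> ('s \<Rightarrow> complex) \<Rightarrow> complex" where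
  "sesq C x y = (\<Sum>s\<in>UNIV. \<Sum>t\<in>UNIV. cnj (x s) * C s t * y t)"

definition psd :: "('s::finite \<Rightarrow> 's \<Rightarrow> complex) \<Rightarrow> bool" where
  "psd C \<longleftrightarrow> (\<forall>x. sesq C x x \<in> \<real>\<^sub>\<ge>\<^sub>0)"

lemma sesq_add_left: "sesq C (\<lambda>s. x s + y s) z = sesq C x z + sesq C y z"
  and sesq_add_right: "sesq C z (\<lambda>s. x s + y s) = sesq C z x + sesq C z y"
  by (simp_all add: sesq_def algebra_simps sum.distrib)

lemma sesq_scale_left: "sesq C (\<lambda>s. c * x s) z = cnj c * sesq C x z"
  and sesq_scale_right: "sesq C z (\<lambda>s. c * x s) = c * sesq C z x"
  by (simp_all add: sesq_def sum_distrib_left mult_ac)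

lemma sesq_sum_left: "sesq C (\<lambda>s. \<Sum>i\<in>I. x i s) z = (\<Sum>i\<in>I. sesq C (x i) z)"
  and sesq_sum_right: "sesq C z (\<lambda>s. \<Sum>i\<in>I. x i s) = (\<Sum>i\<in>I. sesq C z (x i))"
proof -
  have "sesq C (\<lambda>s. \<Sum>i\<in>I. x i s) z = (\<Sum>s\<in>UNIV. \<Sum>t\<in>UNIV. \<Sum>i\<in>I. cnj (x i s) * C s t * z t)"
    by (simp add: sesq_def sum_distrib_right)
  then show "sesq C (\<lambda>s. \<Sum>i\<in>I. x i s) z = (\<Sum>i\<in>I. sesq C (x i) z)"
    by (simp add: sesq_def sum.swap[of _ I])
  have "sesq C z (\<lambda>s. \<Sum>i\<in>I. x i s) = (\<Sum>s\<in>UNIV. \<Sum>t\<in>UNIV. \<Sum>i\<in>I. cnj (z s) * C s t * x i t)"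
    by (simp add: sesq_def sum_distrib_left)
  then show "sesq C z (\<lambda>s. \<Sum>i\<in>I. x i s) = (\<Sum>i\<in>I. sesq C z (x i))"
    by (simp add: sesq_def sum.swap[of _ I])
qed

text \<open>Polarisation: the form is real at \<open>x + y\<close> and at \<open>x + \<i> y\<close>,
  which fixes the imaginary and the real part of \<open>sesq C y x\<close>.\<close>

lemma psd_hermitian:
  assumes "psd C"
  shows "sesq C y x = cnj (sesq C x y)"
proof -
  have pos: "Im (sesq C z z) = 0" for z
    using assms by (simp add: psd_def complex_nonneg_Reals_iff)
  have "Im (sesq C (\<lambda>s. x s + y s) (\<lambda>s. x s + y s)) = 0"
    by (rule pos)
  then have 1: "Im (sesq C x y) + Im (sesq C y x) = 0"
    by (simp add: sesq_add_left sesq_add_right pos)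
  have "Im (sesq C (\<lambda>s. x s + \<i> * y s) (\<lambda>s. x s + \<i> * y s)) = 0"
    by (rule pos)
  then have 2: "Re (sesq C x y) - Re (sesq C y x) = 0"
    by (simp add: sesq_add_left sesq_add_right sesq_scale_left sesq_scale_right pos)
  from 1 2 show ?thesis by (simp add: complex_eq_iff)
qed

lemma psd_cauchy_schwarz:
  assumes C: "psd C"
  shows "(cmod (sesq C x y))\<^sup>2 \<le> Re (sesq C x x) * Re (sesq C y y)"
proof -
  define b where "b = sesq C x y"
  define a where "a = Re (sesq C x x)"
  define c where "c = Re (sesq C y y)"
  have pos: "Re (sesq C z z) \<ge> 0" for z
    using C by (simp add: psd_def complex_nonneg_Reals_iff)
  have quad: "a - 2 * t * (cmod b)\<^sup>2 + t\<^sup>2 * (cmod b)\<^sup>2 * c \<ge> 0" for t :: real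
  proof -
    \<comment> \<open>The phase \<open>cnj b\<close> makes both cross terms real, so positivity at
      \<open>x + l y\<close> becomes a quadratic inequality in the real parameter
      \<open>t\<close>.\<close>
    define l where "l = - of_real t * cnj b"
    have r: "Re (sesq C (\<lambda>s. x s + l * y s) (\<lambda>s. x s + l * y s)) = a + Re (l * b) + Re (cnj l * cnj b) + (Re l * Re l + Im l * Im l) * c"
      using psd_hermitian[OF C, of y x]
      by (simp add: sesq_add_left sesq_add_right sesq_scale_left sesq_scale_right a_def b_def c_def
          algebra_simps)
    have l: "Re (l * b) = - t * (cmod b)\<^sup>2" "Re (cnj l * cnj b) = - t * (cmod b)\<^sup>2"
        "Re l * Re l + Im l * Im l = t\<^sup>2 * (cmod b)\<^sup>2"
      unfolding cmod_power2 by (simp_all add: l_def power2_eq_square algebra_simps)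
    show ?thesis
      using pos[of "\<lambda>s. x s + l * y s"] unfolding r l by simp
  qed
  have "c \<ge> 0" "a \<ge> 0" by (auto simp: c_def a_def pos)
  have "(cmod b)\<^sup>2 \<le> a * c"
  proof (cases "c = 0")
    case True
    have "(cmod b)\<^sup>2 = 0"
    proof (rule ccontr)
      assume "(cmod b)\<^sup>2 \<noteq> 0"
      \<comment> \<open>For \<open>c = 0\<close> the polynomial is affine in \<open>t\<close>, and
        at this \<open>t\<close> its value is \<open>- a - 2\<close>.\<close>
      then show False
        using quad[of "(a + 1) / (cmod b)\<^sup>2"] True \<open>a \<ge> 0\<close> by simp
    qed
    then show ?thesis using True by simp
  next
    case False
    then have "c > 0" using \<open>c \<ge> 0\<close> by simp
    \<comment> \<open>For \<open>c > 0\<close>, the minimum over \<open>t\<close> is at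
      \<open>1 / c\<close>.\<close>
    then show ?thesis
      using quad[of "1 / c"] by (simp add: field_simps power2_eq_square)
  qed
  then show ?thesis by (simp add: a_def b_def c_def)
qed

text \<open>Let P be the orthogonal projection onto the span of the \<open>x j\<close>, each of
  squared norm \<open>N\<close>. The left side is \<open>N\<close> times the trace of PC, and the
  trace of (1 - P) C (1 - P) is nonnegative. This avoids completing the \<open>x j\<close> to a
  basis.\<close>

lemma psd_bessel:
  fixes x :: "nat \<Rightarrow> 's::finite \<Rightarrow> complex"
  assumes C: "psd C" and N: "N > 0"
    and orth: "\<And>i j. i < m \<Longrightarrow> j < m \<Longrightarrow> (\<Sum>s\<in>UNIV. cnj (x i s) * x j s) = (if i = j then of_real N else 0)"
  shows "(\<Sum>j<m. Re (sesq C (x j) (x j))) \<le> N * (\<Sum>s\<in>UNIV. Re (C s s))"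
proof -
  define e :: "'s \<Rightarrow> 's \<Rightarrow> complex" where "e r s = (if s = r then 1 else 0)" for r s
  \<comment> \<open>With these coefficients \<open>z r\<close> is (1 - P) applied to the basis
    vector \<open>e r\<close>.\<close>
  define \<alpha> where "\<alpha> r j = - cnj (x j r) / N" for r j
  define z where "z r s = e r s + (\<Sum>j<m. \<alpha> r j * x j s)" for r s
  have e_left: "sesq C (e r) y = (\<Sum>t\<in>UNIV. C r t * y t)" for r y
  proof -
    have "sesq C (e r) y = (\<Sum>s\<in>UNIV. if s = r then \<Sum>t\<in>UNIV. C s t * y t else 0)"
      unfolding sesq_def e_def by (intro sum.cong refl) auto
    then show ?thesis by simp
  qed
  have e_right: "sesq C y (e r) = (\<Sum>s\<in>UNIV. cnj (y s) * C s r)" for r y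
    unfolding sesq_def e_def by (simp add: if_distrib cong: if_cong)
  have ee: "sesq C (e r) (e r) = C r r" for r
    by (simp add: e_left) (simp add: e_def if_distrib cong: if_cong)
  define S where "S = (\<Sum>j<m. sesq C (x j) (x j))"
  have zz: "sesq C (z r) (z r) = C r r + (\<Sum>j<m. \<alpha> r j * sesq C (e r) (x j))
      + (\<Sum>j<m. cnj (\<alpha> r j) * sesq C (x j) (e r))
      + (\<Sum>i<m. \<Sum>j<m. cnj (\<alpha> r i) * \<alpha> r j * sesq C (x i) (x j))" for r
    unfolding z_def by (simp add: sesq_add_left sesq_add_right sesq_sum_left sesq_sum_right
        sesq_scale_left sesq_scale_right ee sum_distrib_left mult_ac sum.distrib)
  have 1: "(\<Sum>r\<in>UNIV. \<Sum>j<m. \<alpha> r j * sesq C (e r) (x j)) = - S / N"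
  proof -
    have "(\<Sum>r\<in>UNIV. \<alpha> r j * sesq C (e r) (x j)) = - sesq C (x j) (x j) / N" for j
      unfolding e_left unfolding sesq_def
      by (simp add: \<alpha>_def sum_distrib_left sum_divide_distrib sum_negf mult_ac)
    then show ?thesis
      by (subst sum.swap) (simp add: S_def sum_divide_distrib sum_negf)
  qed
  have 2: "(\<Sum>r\<in>UNIV. \<Sum>j<m. cnj (\<alpha> r j) * sesq C (x j) (e r)) = - S / N"
  proof -
    have "(\<Sum>r\<in>UNIV. cnj (\<alpha> r j) * sesq C (x j) (e r)) = - sesq C (x j) (x j) / N" for j
      unfolding e_right unfolding sesq_def sum.swap[of "\<lambda>s t. cnj (x j s) * C s t * x j t"]
      by (simp add: \<alpha>_def sum_distrib_left sum_divide_distrib sum_negf mult_ac)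
    then show ?thesis
      by (subst sum.swap) (simp add: S_def sum_divide_distrib sum_negf)
  qed
  \<comment> \<open>Orthogonality enters here: it expresses that P is idempotent, so the quadratic
    term cancels one of the two linear ones.\<close>
  have 3: "(\<Sum>r\<in>UNIV. \<Sum>i<m. \<Sum>j<m. cnj (\<alpha> r i) * \<alpha> r j * sesq C (x i) (x j)) = S / N"
  proof -
    have "(\<Sum>r\<in>UNIV. cnj (\<alpha> r i) * \<alpha> r j * sesq C (x i) (x j)) = (if j = i then sesq C (x i) (x j) / N else 0)"
      if "i < m" "j < m" for i j
    proof -
      have "(\<Sum>r\<in>UNIV. cnj (\<alpha> r i) * \<alpha> r j * sesq C (x i) (x j))
          = (\<Sum>r\<in>UNIV. cnj (x j r) * x i r) * sesq C (x i) (x j) / (N * N)"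
        by (simp add: \<alpha>_def sum_distrib_left sum_distrib_right sum_divide_distrib mult_ac)
      then show ?thesis using orth[OF that(2,1)] N by simp
    qed
    then have "(\<Sum>i<m. \<Sum>j<m. \<Sum>r\<in>UNIV. cnj (\<alpha> r i) * \<alpha> r j * sesq C (x i) (x j)) = S / N"
      by (simp add: S_def sum_divide_distrib)
    moreover have "(\<Sum>r\<in>UNIV. \<Sum>i<m. \<Sum>j<m. cnj (\<alpha> r i) * \<alpha> r j * sesq C (x i) (x j))
      = (\<Sum>i<m. \<Sum>j<m. \<Sum>r\<in>UNIV. cnj (\<alpha> r i) * \<alpha> r j * sesq C (x i) (x j))"
      by (simp add: sum.swap[of _ "{..<m}" UNIV])
    ultimately show ?thesis by simp
  qed
  have "(\<Sum>r\<in>UNIV. sesq C (z r) (z r)) = (\<Sum>r\<in>UNIV. C r r) - S / N"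
    by (simp add: zz sum.distrib 1 2 3)
  moreover have "0 \<le> Re (\<Sum>r\<in>UNIV. sesq C (z r) (z r))"
    using C by (auto simp: psd_def complex_nonneg_Reals_iff intro!: sum_nonneg)
  ultimately have "Re S / N \<le> (\<Sum>r\<in>UNIV. Re (C r r))"
    by simp
  then show ?thesis
    using N by (simp add: S_def field_simps)
qed

section \<open>Choi matrices\<close>

text \<open>The unnormalised Choi matrix. The output index precedes the input index, as in
  \<open>opvec\<close>, so that the map with a single Kraus operator \<open>K\<close> has the
  rank-one Choi matrix of the vector \<open>opvec K\<close>.\<close>

definition choi :: "('n::finite, 'm::finite) superop \<Rightarrow> 'm \<times> 'n \<Rightarrow> 'm \<times> 'n \<Rightarrow> complex" where
  "choi E s t = E (matrix_unit (snd s) (snd t)) $ fst s $ fst t"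

definition opvec :: "complex^'n^'m \<Rightarrow> 'm::finite \<times> 'n::finite \<Rightarrow> complex" where
  "opvec V s = V $ fst s $ snd s"

lemma sum_delta_mult: "(\<Sum>l\<in>UNIV. a l * (if l = q then c else 0) * b l) = a q * c * b q"
  for a b :: "'i::finite \<Rightarrow> complex"
proof -
  have "a l * (if l = q then c else 0) * b l = (if l = q then a q * c * b q else 0)" for l
    by simp
  then show ?thesis by simp
qed

text \<open>This block matrix is the unnormalised projection onto the maximally entangled vector;
  its quadratic form is the squared modulus of the sum of the entries
  \<open>v p $ p\<close>.\<close>

lemma psd_on_matrix_units: "psd_on UNIV (\<lambda>p q. matrix_unit p q :: 'n::finite operator)"
  unfolding psd_on_def
proof
  fix v :: "'n \<Rightarrow> complex^'n"
  define z where "z = (\<Sum>p\<in>UNIV. v p $ p)"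
  have "(\<Sum>k\<in>UNIV. \<Sum>l\<in>UNIV. cnj (v p $ k) * matrix_unit p q $ k $ l * v q $ l) = cnj (v p $ p) * v q $ q" for p q
  proof -
    have "(\<Sum>l\<in>UNIV. cnj (v p $ k) * matrix_unit p q $ k $ l * v q $ l) = (if k = p then cnj (v p $ p) * v q $ q else 0)" for k
      using sum_delta_mult[of "\<lambda>l. cnj (v p $ p)" q 1 "\<lambda>l. v q $ l"] by (simp add: matrix_unit_nth)
    then show ?thesis by simp
  qed
  then have "(\<Sum>p\<in>UNIV. \<Sum>q\<in>UNIV. \<Sum>k\<in>UNIV. \<Sum>l\<in>UNIV. cnj (v p $ k) * matrix_unit p q $ k $ l * v q $ l) = cnj z * z"
    by (simp add: z_def sum_product)
  also have "\<dots> \<in> \<real>\<^sub>\<ge>\<^sub>0"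
    by (simp add: complex_nonneg_Reals_iff)
  finally show "(\<Sum>p\<in>UNIV. \<Sum>q\<in>UNIV. \<Sum>k\<in>UNIV. \<Sum>l\<in>UNIV. cnj (v p $ k) * matrix_unit p q $ k $ l * v q $ l) \<in> \<real>\<^sub>\<ge>\<^sub>0" .
qed

lemma psd_choi:
  fixes E :: "('n::finite, 'm::finite) superop"
  assumes "completely_positive E"
  shows "psd (choi E)"
  unfolding psd_def
proof
  fix x :: "'m \<times> 'n \<Rightarrow> complex"
  have "psd_on UNIV (\<lambda>p q. E (matrix_unit p q))"
    by (rule cp_psd_on[OF assms _ psd_on_matrix_units]) simp
  then have "(\<Sum>p\<in>UNIV. \<Sum>q\<in>UNIV. \<Sum>k\<in>UNIV. \<Sum>l\<in>UNIV. cnj (x (k, p)) * E (matrix_unit p q) $ k $ l * x (l, q)) \<in> \<real>\<^sub>\<ge>\<^sub>0"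
    unfolding psd_on_def by (drule_tac x = "\<lambda>p. \<chi> k. x (k, p)" in spec) simp
  also have "(\<Sum>p\<in>UNIV. \<Sum>q\<in>UNIV. \<Sum>k\<in>UNIV. \<Sum>l\<in>UNIV. cnj (x (k, p)) * E (matrix_unit p q) $ k $ l * x (l, q))
    = (\<Sum>p\<in>UNIV. \<Sum>k\<in>UNIV. \<Sum>q\<in>UNIV. \<Sum>l\<in>UNIV. cnj (x (k, p)) * E (matrix_unit p q) $ k $ l * x (l, q))"
    by (intro sum.cong refl, rule sum.swap)
  also have "\<dots> = (\<Sum>p\<in>UNIV. \<Sum>k\<in>UNIV. \<Sum>l\<in>UNIV. \<Sum>q\<in>UNIV. cnj (x (k, p)) * E (matrix_unit p q) $ k $ l * x (l, q))"
    by (intro sum.cong refl, rule sum.swap)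
  also have "\<dots> = sesq (choi E) x x"
    by (subst sum.swap) (simp add: sesq_def sum_UNIV_pair choi_def)
  finally show "sesq (choi E) x x \<in> \<real>\<^sub>\<ge>\<^sub>0" .
qed

text \<open>A Choi index of a product map lists both outputs and then both inputs. Regrouping it by
  subsystem lets form and trace factor.\<close>

lemma sum_UNIV_pair_pair:
  "(\<Sum>s\<in>UNIV. f s) = (\<Sum>x\<in>UNIV. \<Sum>y\<in>UNIV. f ((fst x, fst y), (snd x, snd y)))"
  for f :: "('a::finite \<times> 'b::finite) \<times> ('c::finite \<times> 'd::finite) \<Rightarrow> 'e::comm_monoid_add"
proof -
  have "(\<Sum>s\<in>UNIV. f s) = (\<Sum>a\<in>UNIV. \<Sum>b\<in>UNIV. \<Sum>c\<in>UNIV. \<Sum>d\<in>UNIV. f ((a, b), (c, d)))"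
    by (simp add: sum_UNIV_pair)
  also have "\<dots> = (\<Sum>a\<in>UNIV. \<Sum>c\<in>UNIV. \<Sum>b\<in>UNIV. \<Sum>d\<in>UNIV. f ((a, b), (c, d)))"
    by (intro sum.cong refl, rule sum.swap)
  finally show ?thesis by (simp add: sum_UNIV_pair)
qed

lemma choi_tensor_map:
  assumes "clinear E" "clinear F"
  shows "choi (tensor_map E F) ((fst x, fst y), (snd x, snd y)) ((fst x', fst y'), (snd x', snd y'))
    = choi E x x' * choi F y y'"
  by (simp add: choi_def matrix_unit_pair tensor_map_tensor_op assms)

lemma sesq_choi_tensor_map:
  assumes "clinear E" "clinear F"
  shows "sesq (choi (tensor_map E F)) (opvec (tensor_op A B)) (opvec (tensor_op C D))
    = sesq (choi E) (opvec A) (opvec C) * sesq (choi F) (opvec B) (opvec D)"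
proof -
  define f where "f x x' = cnj (opvec A x) * choi E x x' * opvec C x'" for x x'
  define g where "g y y' = cnj (opvec B y) * choi F y y' * opvec D y'" for y y'
  have "sesq (choi (tensor_map E F)) (opvec (tensor_op A B)) (opvec (tensor_op C D))
    = (\<Sum>x\<in>UNIV. \<Sum>y\<in>UNIV. \<Sum>x'\<in>UNIV. \<Sum>y'\<in>UNIV. f x x' * g y y')"
    unfolding sesq_def sum_UNIV_pair_pair choi_tensor_map[OF assms] f_def g_def
    by (simp add: opvec_def mult_ac)
  also have "\<dots> = (\<Sum>x\<in>UNIV. \<Sum>x'\<in>UNIV. f x x') * (\<Sum>y\<in>UNIV. \<Sum>y'\<in>UNIV. g y y')"
    by (simp add: sum_distrib_left[symmetric] sum_distrib_right[symmetric])
  finally show ?thesis by (simp add: sesq_def f_def g_def)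
qed

lemma choi_trace_tensor_map:
  assumes "clinear E" "clinear F"
  shows "(\<Sum>s\<in>UNIV. choi (tensor_map E F) s s) = (\<Sum>s\<in>UNIV. choi E s s) * (\<Sum>s\<in>UNIV. choi F s s)"
  unfolding sum_UNIV_pair_pair choi_tensor_map[OF assms] by (simp add: sum_product)

lemma choi_trace: "(\<Sum>s\<in>UNIV. choi E s s) = (\<Sum>p\<in>UNIV. trace (E (matrix_unit p p)))"
  unfolding sum_UNIV_pair by (subst sum.swap) (simp add: choi_def trace_def)

lemma sum_opvec: "(\<Sum>s\<in>UNIV. cnj (opvec A s) * opvec B s) = of_nat CARD('n) * hs_inner A B"
  for A B :: "'n::finite operator"
  unfolding sum_UNIV_pair
  by (subst sum.swap) (simp add: opvec_def hs_inner_def trace_def matrix_mult_nth)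

section \<open>The dual witness\<close>

text \<open>The witness is \<open>2 * overlap V - choi_weight\<close>, where \<open>V\<close> is \<open>U\<close> with all Schmidt coefficients
  replaced by 1. Both terms carry the same factor, the square of the dimension.\<close>

definition choi_fun :: "('m::finite \<times> 'n::finite \<Rightarrow> 'm \<times> 'n \<Rightarrow> complex) \<Rightarrow> ('n, 'm) superop \<Rightarrow> real" where
  "choi_fun c F = Re (\<Sum>s\<in>UNIV. \<Sum>t\<in>UNIV. c s t * choi F s t)"

definition overlap :: "'n::finite operator \<Rightarrow> ('n, 'n) superop \<Rightarrow> real" where
  "overlap V = choi_fun (\<lambda>s t. cnj (opvec V s) * opvec V t)"

definition choi_weight :: "('n::finite, 'n) superop \<Rightarrow> real" where
  "choi_weight = choi_fun (\<lambda>s t. if s = t then of_nat CARD('n) else 0)"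

text \<open>Additivity, scaling and continuity are shown for arbitrary coefficients
  \<open>c\<close>, so that \<open>overlap\<close> and \<open>choi_weight\<close> share
  them.\<close>

lemma choi_fun_sum: "choi_fun c (\<lambda>X. \<Sum>i\<in>I. F i X) = (\<Sum>i\<in>I. choi_fun c (F i))"
proof -
  have "(\<Sum>s\<in>UNIV. \<Sum>t\<in>UNIV. \<Sum>i\<in>I. c s t * choi (F i) s t) = (\<Sum>i\<in>I. \<Sum>s\<in>UNIV. \<Sum>t\<in>UNIV. c s t * choi (F i) s t)"
    by (simp add: sum.swap[of _ I])
  then show ?thesis
    by (simp add: choi_fun_def choi_def sum_distrib_left)
qed

lemma choi_fun_scaleR: "choi_fun c (\<lambda>X. r *\<^sub>R F X) = r * choi_fun c F"
proof -
  have "(\<Sum>s\<in>UNIV. \<Sum>t\<in>UNIV. c s t * choi (\<lambda>X. r *\<^sub>R F X) s t)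
    = of_real r * (\<Sum>s\<in>UNIV. \<Sum>t\<in>UNIV. c s t * choi F s t)"
    by (simp add: choi_def sum_distrib_left scaleR_eq_cscale mult_ac)
  then show ?thesis by (simp add: choi_fun_def)
qed

lemma choi_fun_tendsto:
  assumes "\<And>X. ((\<lambda>i. F i X) \<longlongrightarrow> G X) net"
  shows "((\<lambda>i. choi_fun c (F i)) \<longlongrightarrow> choi_fun c G) net"
  unfolding choi_fun_def choi_def by (intro tendsto_intros assms)

lemma choi_fun_has_sum:
  assumes "\<And>X. ((\<lambda>i. F i X) has_sum G X) I"
  shows "((\<lambda>i. choi_fun c (F i)) has_sum choi_fun c G) I"
  using choi_fun_tendsto[of "\<lambda>J X. \<Sum>i\<in>J. F i X" G "finite_subsets_at_top I" c] assms
  by (simp add: has_sum_def choi_fun_sum)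

lemma overlap_eq: "overlap V F = Re (sesq (choi F) (opvec V) (opvec V))"
  by (simp add: overlap_def choi_fun_def sesq_def mult_ac)

lemma choi_weight_eq: "choi_weight F = CARD('n) * Re (\<Sum>s\<in>UNIV. choi F s s)"
  for F :: "('n::finite, 'n) superop"
proof -
  have "(\<Sum>t\<in>UNIV. (if s = t then of_nat CARD('n) else 0) * choi F s t) = of_nat CARD('n) * choi F s s" for s
    using sum_delta_mult[of "\<lambda>t. 1" s "of_nat CARD('n)" "choi F s"] by (simp add: eq_commute)
  then show ?thesis
    by (simp add: choi_weight_def choi_fun_def sum_distrib_left)
qed

lemma choi_weight_trace_preserving:
  fixes F :: "('n::finite, 'n) superop"
  assumes "trace_preserving F"
  shows "choi_weight F = (real CARD('n))\<^sup>2"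
  using assms by (simp add: choi_weight_eq choi_trace trace_preserving_def trace_matrix_unit power2_eq_square)

text \<open>For Gram matrices \<open>M\<close> and \<open>N\<close> of positive forms, \<open>\<bar>M\<^sub>i\<^sub>j\<bar> \<le> \<surd>(M\<^sub>i\<^sub>i M\<^sub>j\<^sub>j)\<close> and the
  Cauchy-Schwarz inequality bound \<open>\<Sum> M\<^sub>i\<^sub>j N\<^sub>i\<^sub>j\<close> by the product of the traces.\<close>

lemma overlap_tensor_map:
  fixes L :: "nat \<Rightarrow> 'a::finite operator" and R :: "nat \<Rightarrow> 'b::finite operator"
  assumes E: "completely_positive E" and F: "completely_positive F"
    and L: "hs_orthonormal m L" and R: "hs_orthonormal m R"
  defines "V \<equiv> \<Sum>j<m. tensor_op (L j) (R j)"
  shows "0 \<le> overlap V (tensor_map E F)" and "overlap V (tensor_map E F) \<le> choi_weight (tensor_map E F)"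
proof -
  note cl = cp_clinear[OF E] cp_clinear[OF F]
  have "psd (choi (tensor_map E F))"
    by (intro psd_choi cp_tensor_map E F)
  then show "0 \<le> overlap V (tensor_map E F)"
    by (simp add: overlap_eq psd_def complex_nonneg_Reals_iff)
  have pE: "psd (choi E)" and pF: "psd (choi F)"
    by (intro psd_choi E F)+
  define M where "M i j = sesq (choi E) (opvec (L i)) (opvec (L j))" for i j
  define N where "N i j = sesq (choi F) (opvec (R i)) (opvec (R j))" for i j
  define a where "a i = Re (M i i)" for i
  define b where "b i = Re (N i i)" for i
  have a0: "a i \<ge> 0" and b0: "b i \<ge> 0" for i
    using pE pF by (simp_all add: a_def b_def M_def N_def psd_def complex_nonneg_Reals_iff)
  have Mb: "cmod (M i j) \<le> sqrt (a i) * sqrt (a j)" for i j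
    using psd_cauchy_schwarz[OF pE, of "opvec (L i)" "opvec (L j)"] a0
    by (auto simp: a_def M_def real_sqrt_mult[symmetric] intro!: real_le_rsqrt)
  have Nb: "cmod (N i j) \<le> sqrt (b i) * sqrt (b j)" for i j
    using psd_cauchy_schwarz[OF pF, of "opvec (R i)" "opvec (R j)"] b0
    by (auto simp: b_def N_def real_sqrt_mult[symmetric] intro!: real_le_rsqrt)
  have V: "opvec V = (\<lambda>s. \<Sum>j<m. opvec (tensor_op (L j) (R j)) s)"
    by (simp add: V_def opvec_def fun_eq_iff)
  have "overlap V (tensor_map E F) = Re (\<Sum>i<m. \<Sum>j<m. M i j * N i j)"
    unfolding overlap_eq V sesq_sum_left sesq_sum_right sesq_choi_tensor_map[OF cl] M_def N_def ..
  also have "\<dots> \<le> cmod (\<Sum>i<m. \<Sum>j<m. M i j * N i j)"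
    by (rule complex_Re_le_cmod)
  also have "\<dots> \<le> (\<Sum>i<m. \<Sum>j<m. cmod (M i j * N i j))"
    by (rule order_trans[OF norm_sum sum_mono]) (rule norm_sum)
  also have "\<dots> \<le> (\<Sum>i<m. \<Sum>j<m. (sqrt (a i) * sqrt (b i)) * (sqrt (a j) * sqrt (b j)))"
  proof (intro sum_mono)
    fix i j
    have "cmod (M i j) * cmod (N i j) \<le> (sqrt (a i) * sqrt (a j)) * (sqrt (b i) * sqrt (b j))"
      by (intro mult_mono Mb Nb mult_nonneg_nonneg) (auto simp: a0 b0)
    then show "cmod (M i j * N i j) \<le> (sqrt (a i) * sqrt (b i)) * (sqrt (a j) * sqrt (b j))"
      by (simp add: norm_mult mult_ac)
  qed
  also have "\<dots> = (\<Sum>i<m. sqrt (a i) * sqrt (b i))\<^sup>2"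
    by (simp add: power2_eq_square sum_product)
  also have "\<dots> \<le> (\<Sum>i<m. (sqrt (a i))\<^sup>2) * (\<Sum>i<m. (sqrt (b i))\<^sup>2)"
    by (rule Cauchy_Schwarz_ineq_sum)
  also have "\<dots> = (\<Sum>i<m. a i) * (\<Sum>i<m. b i)"
    by (simp add: a0 b0)
  \<comment> \<open>Bessel on each side: the inner product in \<open>hs_orthonormal\<close> is
    normalised, so the vectors \<open>opvec (L i)\<close> have squared norm \<open>CARD('a)\<close>,
    and those of \<open>R\<close> have \<open>CARD('b)\<close>.\<close>
  also have "\<dots> \<le> (CARD('a) * (\<Sum>s\<in>UNIV. Re (choi E s s))) * (CARD('b) * (\<Sum>s\<in>UNIV. Re (choi F s s)))"
  proof (rule mult_mono)
    show 1: "(\<Sum>i<m. a i) \<le> CARD('a) * (\<Sum>s\<in>UNIV. Re (choi E s s))"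
      unfolding a_def M_def by (rule psd_bessel[OF pE]) (use L in \<open>auto simp: sum_opvec hs_orthonormal_def\<close>)
    show "(\<Sum>i<m. b i) \<le> CARD('b) * (\<Sum>s\<in>UNIV. Re (choi F s s))"
      unfolding b_def N_def by (rule psd_bessel[OF pF]) (use R in \<open>auto simp: sum_opvec hs_orthonormal_def\<close>)
    show "0 \<le> CARD('a) * (\<Sum>s\<in>UNIV. Re (choi E s s))"
      by (rule order_trans[OF _ 1]) (auto intro: sum_nonneg a0)
    show "0 \<le> (\<Sum>i<m. b i)"
      by (auto intro: sum_nonneg b0)
  qed
  also have "\<dots> = choi_weight (tensor_map E F)"
  proof -
    \<comment> \<open>\<open>choi_weight\<close> takes the real part of a product of two traces; it
      splits into the product of real parts because one trace is real.\<close>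
    have im: "Im (\<Sum>s\<in>UNIV. choi E s s) = 0"
    proof -
      have "Im (choi E s s) = 0" for s
      proof -
        have "choi E s s = sesq (choi E) (\<lambda>r. if r = s then 1 else 0) (\<lambda>r. if r = s then 1 else 0)"
        proof -
          have "(\<Sum>t\<in>UNIV. cnj (if r = s then 1 else 0) * choi E r t * (if t = s then 1 else 0))
              = (if r = s then choi E s s else 0)" for r
            using sum_delta_mult[of "\<lambda>t. choi E s t" s 1 "\<lambda>t. 1"] by simp
          then show ?thesis by (simp add: sesq_def)
        qed
        then show ?thesis
          using pE by (simp add: psd_def complex_nonneg_Reals_iff)
      qed
      then show ?thesis by simp
    qed
    then show ?thesis
      unfolding choi_weight_eq choi_trace_tensor_map[OF cl] by (simp add: mult_ac)
  qed
  finally show "overlap V (tensor_map E F) \<le> choi_weight (tensor_map E F)" .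
qed

text \<open>Closing the bounds under composition with product maps makes the cone stable under further
  LOCC rounds.\<close>

definition witness_cone :: "('a::finite \<times> 'b::finite) operator \<Rightarrow> ('a \<times> 'b, 'a \<times> 'b) superop set" where
  "witness_cone V = {F. clinear F \<and> (\<forall>E G. completely_positive E \<longrightarrow> completely_positive G \<longrightarrow>
     0 \<le> overlap V (tensor_map E G \<circ> F) \<and> overlap V (tensor_map E G \<circ> F) \<le> choi_weight (tensor_map E G \<circ> F))}"

lemma witness_cone_tensor_map:
  assumes "completely_positive E" "completely_positive F" "hs_orthonormal m L" "hs_orthonormal m R"
  shows "tensor_map E F \<in> witness_cone (\<Sum>j<m. tensor_op (L j) (R j))"
  using assms overlap_tensor_map[OF cp_compose cp_compose]
  by (auto simp: witness_cone_def clinear_tensor_map tensor_map_compose cp_clinear)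

text \<open>A further product map merges with the one that the cone quantifies over, since products
  of maps compose factorwise.\<close>

lemma witness_cone_compose:
  assumes "F \<in> witness_cone V" "completely_positive E" "completely_positive G"
  shows "tensor_map E G \<circ> F \<in> witness_cone V"
  using assms
  by (auto simp: witness_cone_def clinear_compose clinear_tensor_map tensor_map_compose cp_clinear
      cp_compose o_assoc)

lemma witness_cone_bounds:
  assumes "F \<in> witness_cone V"
  shows "0 \<le> overlap V F" "overlap V F \<le> choi_weight F"
proof -
  have "tensor_map (\<lambda>X. X) (\<lambda>X. X) \<circ> F = F"
    by (simp add: tensor_map_id fun_eq_iff)
  then show "0 \<le> overlap V F" "overlap V F \<le> choi_weight F"
    using assms cp_id[where 'a = 'a] cp_id[where 'a = 'b] unfolding witness_cone_def
    by (metis (no_types, lifting) mem_Collect_eq)+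
qed

lemma witness_cone_sum:
  fixes V :: "('a::finite \<times> 'b::finite) operator"
  assumes "\<And>i. i \<in> I \<Longrightarrow> F i \<in> witness_cone V"
  shows "(\<lambda>X. \<Sum>i\<in>I. F i X) \<in> witness_cone V"
proof -
  have "choi_fun c (tensor_map E G \<circ> (\<lambda>X. \<Sum>i\<in>I. F i X)) = (\<Sum>i\<in>I. choi_fun c (tensor_map E G \<circ> F i))"
    for c and E :: "('a, 'a) superop" and G :: "('b, 'b) superop"
    unfolding choi_fun_sum[symmetric] by (simp add: o_def clinear_sum[OF clinear_tensor_map])
  then show ?thesis
    using assms unfolding witness_cone_def overlap_def choi_weight_def
    by (auto simp add: clinear_sum_fun intro!: sum_nonneg sum_mono)
qed

lemma tendsto_clinear:
  assumes "net \<noteq> bot" "\<And>i. clinear (F i)" "\<And>X. ((\<lambda>i. F i X) \<longlongrightarrow> G X) net"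
  shows "clinear G"
  unfolding clinear_iff
proof (intro conjI allI)
  fix X Y
  have "((\<lambda>i. F i (X + Y)) \<longlongrightarrow> G X + G Y) net"
    by (simp add: clinear_add assms tendsto_add)
  then show "G (X + Y) = G X + G Y"
    using tendsto_unique[OF assms(1,3)] by blast
next
  fix c X
  have "((\<lambda>i. cscale c (F i X)) \<longlongrightarrow> cscale c (G X)) net"
    by (intro vec_tendstoI) (simp add: tendsto_intros assms)
  then show "G (cscale c X) = cscale c (G X)"
    using tendsto_unique[OF assms(1) assms(3)[of "cscale c X"]] by (simp add: clinear_cscale assms)
qed

text \<open>The defining conditions are weak inequalities between functionals that read off finitely
  many values of the map, so pointwise convergence along any proper filter is enough.\<close>

lemma witness_cone_tendsto:
  fixes V :: "('a::finite \<times> 'b::finite) operator"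
  assumes "net \<noteq> bot" "\<And>i. F i \<in> witness_cone V" "\<And>X. ((\<lambda>i. F i X) \<longlongrightarrow> G X) net"
  shows "G \<in> witness_cone V"
proof -
  have lim: "((\<lambda>i. choi_fun c (tensor_map E E' \<circ> F i)) \<longlongrightarrow> choi_fun c (tensor_map E E' \<circ> G)) net"
    for c and E :: "('a, 'a) superop" and E' :: "('b, 'b) superop"
    by (rule choi_fun_tendsto)
      (simp add: bounded_linear.tendsto[OF clinear_bounded_linear[OF clinear_tensor_map]] assms(3))
  have "clinear G"
    by (rule tendsto_clinear[OF assms(1) _ assms(3)]) (use assms(2) in \<open>simp add: witness_cone_def\<close>)
  then show ?thesis
    using assms(1,2) unfolding witness_cone_def overlap_def choi_weight_def
    by (auto intro!: tendsto_lowerbound[OF lim] tendsto_le[OF _ lim lim] always_eventually)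
qed

lemma witness_cone_has_sum:
  assumes "\<And>i. F i \<in> witness_cone V" "\<And>X. ((\<lambda>i. F i X) has_sum G X) I"
  shows "G \<in> witness_cone V"
  by (rule witness_cone_tendsto[of "finite_subsets_at_top I" "\<lambda>J X. \<Sum>i\<in>J. F i X"])
    (use assms in \<open>auto simp: has_sum_def intro: witness_cone_sum\<close>)

section \<open>LOCC instruments and the witness bound\<close>

lemma instrument_cp: "instrument E \<Longrightarrow> completely_positive (E i)"
  by (simp add: instrument_def)

lemma coarse_graining_witness_cone:
  assumes "coarse_graining E F" "\<And>i. E i \<in> witness_cone V"
  shows "F k \<in> witness_cone V"
  using assms unfolding coarse_graining_def by (metis witness_cone_has_sum)

text \<open>Both directions of communication yield products of completely positive maps, which is
  the information the cone needs about a round.\<close>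

lemma one_way_local_cases:
  assumes "one_way_local J"
  obtains E F where "\<And>i. completely_positive (E i)" "\<And>i. completely_positive (F i)"
    "J = (\<lambda>i. tensor_map (E i) (F i))"
  using assms
  unfolding one_way_local_def one_way_local_A_def one_way_local_B_def cptp_def
  by (metis instrument_cp)

lemma LOCC_linked_witness_cone:
  assumes "LOCC_linked F E" "\<And>i. E i \<in> witness_cone V"
  shows "F k \<in> witness_cone V"
proof -
  obtain J where J: "\<And>j. one_way_local (J j)" "coarse_graining (\<lambda>(j, j'). J j j' \<circ> E j) F"
    using assms(1) unfolding LOCC_linked_def by blast
  have "J j j' \<circ> E j \<in> witness_cone V" for j j'
    by (rule one_way_local_cases[OF J(1)[of j]]) (simp add: witness_cone_compose assms(2))
  then show ?thesis
    by (intro coarse_graining_witness_cone[OF J(2)]) auto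
qed

lemma LOCC_round_witness_cone:
  assumes "LOCC_round r F" "hs_orthonormal m L" "hs_orthonormal m R"
  shows "F k \<in> witness_cone (\<Sum>j<m. tensor_op (L j) (R j))"
  using assms(1)
proof (induction arbitrary: k)
  case (one E F)
  have "E i \<in> witness_cone (\<Sum>j<m. tensor_op (L j) (R j))" for i
    by (rule one_way_local_cases[OF one(1)]) (simp add: witness_cone_tensor_map assms(2,3))
  then show ?case
    by (rule coarse_graining_witness_cone[OF one(2)])
next
  case (step r E F)
  then show ?case by (intro LOCC_linked_witness_cone[OF step(2)])
qed

lemma instruments_converge_pointwise:
  assumes "instruments_converge J I" "\<And>i. clinear (I i)" "\<And>n i. n \<ge> 1 \<Longrightarrow> clinear (J n i)"
  shows "(\<lambda>n. J n i X) \<longlonglongrightarrow> I i X"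
proof -
  have "(\<lambda>n. ennreal (onorm (\<lambda>X. J n i X - I i X))) \<longlonglongrightarrow> 0"
  proof (rule tendsto_sandwich[OF _ _ tendsto_const assms(1)[unfolded instruments_converge_def]])
    have "(\<Sum>k\<in>{i}. ennreal (onorm (\<lambda>X. J n k X - I k X))) \<le> (\<Sum>k. ennreal (onorm (\<lambda>X. J n k X - I k X)))" for n
      by (rule sum_le_suminf) auto
    then show "\<forall>\<^sub>F n in sequentially. ennreal (onorm (\<lambda>X. J n i X - I i X)) \<le> (\<Sum>k. ennreal (onorm (\<lambda>X. J n k X - I k X)))"
      by simp
  qed simp
  moreover have bl: "bounded_linear (\<lambda>X. J n i X - I i X)" if "n \<ge> 1" for n
    by (intro bounded_linear_sub clinear_bounded_linear assms that)
  \<comment> \<open>\<open>ennreal\<close> truncates negative numbers, so convergence of the reals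
    is recovered from eventual nonnegativity of the norms.\<close>
  moreover have "\<forall>\<^sub>F n in sequentially. 0 \<le> onorm (\<lambda>X. J n i X - I i X)"
    using eventually_ge_at_top[of 1] by eventually_elim (rule onorm_pos_le[OF bl])
  ultimately have "(\<lambda>n. onorm (\<lambda>X. J n i X - I i X)) \<longlonglongrightarrow> 0"
    by (subst (asm) ennreal_0[symmetric], subst (asm) tendsto_ennreal_iff) auto
  then have "(\<lambda>n. onorm (\<lambda>X. J n i X - I i X) * norm X) \<longlonglongrightarrow> 0"
    by (rule tendsto_mult_left_zero)
  moreover have "\<forall>\<^sub>F n in sequentially. norm (J n i X - I i X) \<le> onorm (\<lambda>X. J n i X - I i X) * norm X"
    using eventually_ge_at_top[of 1] by eventually_elim (rule onorm[OF bl])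
  ultimately have "(\<lambda>n. J n i X - I i X) \<longlonglongrightarrow> 0"
    by (rule Lim_null_comparison[rotated])
  then show ?thesis by (rule LIM_zero_cancel)
qed

lemma LOCC_instrument_witness_cone:
  assumes I: "LOCC_instrument I" and LR: "hs_orthonormal m L" "hs_orthonormal m R"
  shows "I i \<in> witness_cone (\<Sum>j<m. tensor_op (L j) (R j))"
proof -
  let ?V = "\<Sum>j<m. tensor_op (L j) (R j)"
  obtain J J' where J: "\<And>n. n \<ge> 1 \<Longrightarrow> LOCC_round n (J n)" "\<And>n. n \<ge> 1 \<Longrightarrow> coarse_graining (J n) (J' n)"
    "instruments_converge J' I" and inst: "instrument I"
    using I unfolding LOCC_instrument_def by blast
  have J': "J' n i \<in> witness_cone ?V" if "n \<ge> 1" for n i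
    by (rule coarse_graining_witness_cone[OF J(2)[OF that] LOCC_round_witness_cone[OF J(1)[OF that] LR]])
  have "(\<lambda>n. J' n i X) \<longlonglongrightarrow> I i X" for X
    by (rule instruments_converge_pointwise[OF J(3)])
      (use J' inst in \<open>auto simp: instrument_cp cp_clinear witness_cone_def\<close>)
  \<comment> \<open>The term at index 0 is unconstrained; the shift leaves a sequence lying entirely
    in the cone.\<close>
  then have lim: "(\<lambda>n. J' (Suc n) i X) \<longlonglongrightarrow> I i X" for X
    by (rule LIMSEQ_Suc)
  show ?thesis
    by (rule witness_cone_tendsto[OF _ _ lim]) (simp_all add: J')
qed

text \<open>Each outcome contributes at most its own weight in absolute value, also after
  multiplication by its coefficient. The weights add up to that of the total map, fixed by trace
  preservation.\<close>

lemma LOCC_star_witness: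
  fixes L :: "nat \<Rightarrow> 'a::finite operator" and R :: "nat \<Rightarrow> 'b::finite operator"
  assumes F: "F \<in> LOCC_star" and LR: "hs_orthonormal m L" "hs_orthonormal m R"
  defines "V \<equiv> \<Sum>j<m. tensor_op (L j) (R j)"
  shows "\<bar>2 * overlap V F - choi_weight F\<bar> \<le> (real CARD('a \<times> 'b))\<^sup>2"
proof -
  obtain I \<beta> where I: "LOCC_instrument I" and \<beta>: "\<And>i. \<beta> i \<in> {-1..1::real}"
    and sum: "\<And>X. ((\<lambda>i. \<beta> i *\<^sub>R I i X) has_sum F X) UNIV"
    using F unfolding LOCC_star_def Qstar_def by blast
  obtain T where T: "\<And>X. ((\<lambda>i. I i X) has_sum T X) UNIV" "trace_preserving T"
    using I unfolding LOCC_instrument_def instrument_def by blast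
  define w where "w i = 2 * overlap V (I i) - choi_weight (I i)" for i
  have w: "\<bar>w i\<bar> \<le> choi_weight (I i)" for i
    using witness_cone_bounds[OF LOCC_instrument_witness_cone[OF I LR, of i]]
    by (simp add: w_def V_def abs_le_iff)
  have bnd: "\<bar>\<beta> i * w i\<bar> \<le> choi_weight (I i)" for i
  proof -
    have "\<bar>\<beta> i * w i\<bar> \<le> 1 * \<bar>w i\<bar>"
      unfolding abs_mult by (rule mult_right_mono) (use \<beta>[of i] in auto)
    with w[of i] show ?thesis by simp
  qed
  have "((\<lambda>i. overlap V (\<lambda>X. \<beta> i *\<^sub>R I i X)) has_sum overlap V F) UNIV"
    "((\<lambda>i. choi_weight (\<lambda>X. \<beta> i *\<^sub>R I i X)) has_sum choi_weight F) UNIV"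
    unfolding overlap_def choi_weight_def by (intro choi_fun_has_sum sum)+
  then have "((\<lambda>i. 2 * (\<beta> i * overlap V (I i)) + - (\<beta> i * choi_weight (I i))) has_sum 2 * overlap V F + - choi_weight F) UNIV"
    unfolding overlap_def choi_weight_def choi_fun_scaleR
    by (intro has_sum_add has_sum_cmult_right) (simp_all add: has_sum_uminus)
  then have S: "((\<lambda>i. \<beta> i * w i) has_sum (2 * overlap V F - choi_weight F)) UNIV"
    by (simp add: w_def algebra_simps)
  have C: "((\<lambda>i. choi_weight (I i)) has_sum choi_weight T) UNIV"
    unfolding choi_weight_def by (intro choi_fun_has_sum T)
  have "2 * overlap V F - choi_weight F \<le> choi_weight T"
    by (rule has_sum_mono[OF S C]) (use bnd in \<open>auto simp: abs_le_iff\<close>)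
  moreover have "- choi_weight T \<le> 2 * overlap V F - choi_weight F"
    by (rule has_sum_mono[OF _ S, of "\<lambda>i. - choi_weight (I i)"])
      (use bnd C in \<open>auto simp: abs_le_iff has_sum_uminus minus_le_iff\<close>)
  ultimately show ?thesis
    by (simp only: choi_weight_trace_preserving[OF T(2)] abs_le_iff) auto
qed

section \<open>The value of the witness on the unitary channel\<close>

lemma trace_preserving_unitary_channel:
  assumes "unitary_op U"
  shows "trace_preserving (unitary_channel U)"
  unfolding trace_preserving_def unitary_channel_def
proof (intro conjI allI clinear_sandwich)
  fix X
  have "trace (U ** X ** dagger U) = trace (dagger U ** (U ** X))"
    by (rule trace_mul_sym)
  then show "trace (U ** X ** dagger U) = trace X"
    using assms by (simp add: matrix_mul_assoc unitary_op_def)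
qed

lemma matrix_unit_sandwich: "(A ** matrix_unit p q ** dagger B) $ k $ l = A $ k $ p * cnj (B $ l $ q)"
proof -
  have "(A ** matrix_unit p q) $ k $ b = (if b = q then A $ k $ p else 0)" for b
    using sum_delta_mult[of "\<lambda>a. A $ k $ a" p 1 "\<lambda>a. 1"] by (simp add: matrix_mult_nth matrix_unit_nth)
  then show ?thesis
    using sum_delta_mult[of "\<lambda>a. 1" q "A $ k $ p" "\<lambda>b. cnj (B $ l $ b)"] by (simp add: matrix_mult_nth[of "_ ** _"])
qed

text \<open>The Choi matrix has rank one, given by \<open>opvec U\<close>; the dimension factor
  undoes the normalisation of \<open>hs_inner\<close>.\<close>

lemma overlap_unitary_channel:
  "overlap V (unitary_channel U) = (real CARD('n) * cmod (hs_inner V U))\<^sup>2"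
  for U V :: "'n::finite operator"
proof -
  have ch: "choi (unitary_channel U) s t = opvec U s * cnj (opvec U t)" for s t
    by (simp add: choi_def unitary_channel_def matrix_unit_sandwich opvec_def)
  define z where "z = (\<Sum>s\<in>UNIV. cnj (opvec V s) * opvec U s)"
  have "sesq (choi (unitary_channel U)) (opvec V) (opvec V) = z * cnj z"
    by (simp add: sesq_def ch z_def sum_product mult_ac)
  then have "overlap V (unitary_channel U) = (cmod z)\<^sup>2"
    by (simp add: overlap_eq complex_norm_square[symmetric] del: of_real_power)
  then show ?thesis
    by (simp add: z_def sum_opvec norm_mult)
qed

lemma hs_inner_opvec: "hs_inner A B = (\<Sum>s\<in>UNIV. cnj (opvec A s) * opvec B s) / of_nat CARD('n)"
  for A B :: "'n::finite operator"
  by (simp add: sum_opvec)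

lemma hs_inner_sum_left: "hs_inner (\<Sum>i\<in>I. A i) B = (\<Sum>i\<in>I. hs_inner (A i) B)"
proof -
  have "(\<Sum>s\<in>UNIV. \<Sum>i\<in>I. cnj (opvec (A i) s) * opvec B s) = (\<Sum>i\<in>I. \<Sum>s\<in>UNIV. cnj (opvec (A i) s) * opvec B s)"
    by (rule sum.swap)
  then show ?thesis
    by (simp add: hs_inner_opvec opvec_def sum_distrib_right sum_divide_distrib[symmetric])
qed

lemma hs_inner_sum_right: "hs_inner B (\<Sum>i\<in>I. A i) = (\<Sum>i\<in>I. hs_inner B (A i))"
proof -
  have "(\<Sum>s\<in>UNIV. \<Sum>i\<in>I. cnj (opvec B s) * opvec (A i) s) = (\<Sum>i\<in>I. \<Sum>s\<in>UNIV. cnj (opvec B s) * opvec (A i) s)"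
    by (rule sum.swap)
  then show ?thesis
    by (simp add: hs_inner_opvec opvec_def sum_distrib_left sum_divide_distrib[symmetric])
qed

lemma hs_inner_scaleR_right: "hs_inner A (r *\<^sub>R B) = of_real r * hs_inner A B"
  and hs_inner_scaleR_left: "hs_inner (r *\<^sub>R A) B = of_real r * hs_inner A B"
  by (simp_all add: hs_inner_opvec opvec_def scaleR_eq_cscale sum_distrib_left mult_ac)

lemma hs_inner_tensor_op: "hs_inner (tensor_op A B) (tensor_op C D) = hs_inner A C * hs_inner B D"
  by (simp add: hs_inner_def dagger_tensor_op tensor_op_mult trace_tensor_op)

lemma hs_inner_unitary:
  fixes U :: "'n::finite operator"
  assumes "unitary_op U"
  shows "hs_inner U U = 1"
  using assms by (simp add: hs_inner_def unitary_op_def trace_def mat_def)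

context
  fixes U :: "('a::finite \<times> 'b::finite) operator"
    and m :: nat and u :: "nat \<Rightarrow> real"
    and L :: "nat \<Rightarrow> 'a operator" and R :: "nat \<Rightarrow> 'b operator"
  assumes schmidt: "operator_schmidt_decomp U m u L R"
begin

lemma schmidt_hs_inner:
  "i < m \<Longrightarrow> j < m \<Longrightarrow> hs_inner (tensor_op (L i) (R i)) (tensor_op (L j) (R j)) = (if i = j then 1 else 0)"
  using schmidt by (simp add: hs_inner_tensor_op operator_schmidt_decomp_def hs_orthonormal_def)

lemma schmidt_hs_inner_U:
  assumes "i < m"
  shows "hs_inner (tensor_op (L i) (R i)) U = u i"
proof -
  have "hs_inner (tensor_op (L i) (R i)) U = (\<Sum>j<m. u j * hs_inner (tensor_op (L i) (R i)) (tensor_op (L j) (R j)))"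
    using schmidt by (simp add: operator_schmidt_decomp_def hs_inner_sum_right hs_inner_scaleR_right)
  also have "\<dots> = (\<Sum>j<m. if j = i then complex_of_real (u i) else 0)"
    by (intro sum.cong refl) (auto simp: schmidt_hs_inner assms)
  finally show ?thesis using assms by simp
qed

lemma schmidt_coeffs_square_sum:
  assumes "unitary_op U"
  shows "(\<Sum>j<m. (u j)\<^sup>2) = 1"
proof -
  have "hs_inner U U = (\<Sum>j<m. u j * hs_inner (tensor_op (L j) (R j)) U)"
    using schmidt hs_inner_sum_left[of "\<lambda>j. u j *\<^sub>R tensor_op (L j) (R j)" "{..<m}" U]
    by (simp add: operator_schmidt_decomp_def hs_inner_scaleR_left)
  also have "\<dots> = (\<Sum>j<m. complex_of_real ((u j)\<^sup>2))"
    by (intro sum.cong refl) (simp add: schmidt_hs_inner_U power2_eq_square)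
  finally show ?thesis
    using hs_inner_unitary[OF assms] by (metis of_real_sum of_real_eq_1_iff)
qed

text \<open>Linear duality: \<open>w\<close> is linear, bounded by \<open>N\<^sup>2\<close> in
  modulus on \<open>LOCC_star\<close>, and evaluated on any decomposition of the channel it bounds
  the sum of the moduli of the coefficients from below.\<close>

lemma qp_extent_LOCC_star_ge:
  assumes U: "unitary_op U"
  shows "ereal (2 * (\<Sum>j<m. u j)\<^sup>2 - 1) \<le> qp_extent LOCC_star (unitary_channel U)"
  unfolding qp_extent_def
proof (rule Inf_greatest, clarify)
  fix k :: nat and a F
  assume F: "\<forall>i<k. F i \<in> LOCC_star" and UF: "unitary_channel U = (\<lambda>X. \<Sum>i<k. a i *\<^sub>R F i X)"
  define V where "V = (\<Sum>j<m. tensor_op (L j) (R j))"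
  define N where "N = real CARD('a \<times> 'b)"
  define w where "w F = 2 * overlap V F - choi_weight F" for F
  have N: "N > 0" by (simp add: N_def)
  have LR: "hs_orthonormal m L" "hs_orthonormal m R"
    using schmidt by (auto simp: operator_schmidt_decomp_def)
  have "hs_inner V U = (\<Sum>j<m. u j)"
    by (simp add: V_def hs_inner_sum_left schmidt_hs_inner_U)
  then have "overlap V (unitary_channel U) = N\<^sup>2 * (\<Sum>j<m. u j)\<^sup>2"
    unfolding overlap_unitary_channel N_def by (simp add: power_mult_distrib norm_of_real del: of_real_sum)
  then have "N\<^sup>2 * (2 * (\<Sum>j<m. u j)\<^sup>2 - 1) = w (unitary_channel U)"
    by (simp add: w_def choi_weight_trace_preserving[OF trace_preserving_unitary_channel[OF U]] N_def algebra_simps)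
  also have "\<dots> = (\<Sum>i<k. a i * w (F i))"
    unfolding UF w_def overlap_def choi_weight_def choi_fun_sum choi_fun_scaleR
    by (simp add: sum_distrib_left sum_subtractf[symmetric] algebra_simps)
  also have "\<dots> \<le> (\<Sum>i<k. \<bar>a i\<bar> * N\<^sup>2)"
  proof (rule sum_mono)
    fix i assume "i \<in> {..<k}"
    then have "\<bar>w (F i)\<bar> \<le> N\<^sup>2"
      using LOCC_star_witness[OF _ LR, of "F i"] F by (simp add: w_def V_def N_def)
    then have "\<bar>a i\<bar> * \<bar>w (F i)\<bar> \<le> \<bar>a i\<bar> * N\<^sup>2"
      by (rule mult_left_mono) simp
    then show "a i * w (F i) \<le> \<bar>a i\<bar> * N\<^sup>2"
      using abs_ge_self[of "a i * w (F i)"] by (simp only: abs_mult)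
  qed
  also have "\<dots> = N\<^sup>2 * (\<Sum>i<k. \<bar>a i\<bar>)"
    by (simp add: sum_distrib_left mult.commute)
  finally show "ereal (2 * (\<Sum>j<m. u j)\<^sup>2 - 1) \<le> ereal (\<Sum>i<k. \<bar>a i\<bar>)"
    using N by simp
qed

end

section \<open>Local operations are LOCC\<close>

text \<open>Summability of complex families is absolute, which gives joint summability over
  pairs.\<close>

lemma has_sum_product:
  fixes f :: "'i \<Rightarrow> complex" and g :: "'j \<Rightarrow> complex"
  assumes f: "(f has_sum a) A" and g: "(g has_sum b) B"
  shows "((\<lambda>(i, j). f i * g j) has_sum a * b) (A \<times> B)"
proof (rule has_sum_SigmaI)
  show "((\<lambda>j. case (i, j) of (i, j) \<Rightarrow> f i * g j) has_sum f i * b) B" for i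
    using has_sum_cmult_right[OF g] by simp
  show "((\<lambda>i. f i * b) has_sum a * b) A"
    by (rule has_sum_cmult_left[OF f])
  have fs: "(\<lambda>i. norm (f i)) summable_on A" and gs: "(\<lambda>j. norm (g j)) summable_on B"
    using f g summable_on_iff_abs_summable_on_complex by (auto simp: summable_on_def)
  have "(\<lambda>i. norm (f i) * (\<Sum>\<^sub>\<infinity>j\<in>B. norm (g j))) summable_on A"
    by (rule summable_on_cmult_left[OF fs])
  moreover have "(\<Sum>\<^sub>\<infinity>j\<in>B. norm (g j)) \<ge> 0"
    by (rule infsum_nonneg) simp
  ultimately have "(\<lambda>x. norm (case x of (i, j) \<Rightarrow> f i * g j)) summable_on A \<times> B"
    using gs by (subst Infinite_Sum.abs_summable_on_Sigma_iff) (simp add: norm_mult summable_on_cmult_right infsum_cmult_right' abs_mult)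
  then show "(\<lambda>(i, j). f i * g j) summable_on A \<times> B"
    by (rule abs_summable_summable)
qed

lemma has_sum_sum:
  fixes f :: "'k \<Rightarrow> 'i \<Rightarrow> 'a::topological_comm_monoid_add"
  assumes "\<And>k. k \<in> K \<Longrightarrow> (f k has_sum S k) A"
  shows "((\<lambda>i. \<Sum>k\<in>K. f k i) has_sum (\<Sum>k\<in>K. S k)) A"
  using assms by (induction K rule: infinite_finite_induct) (auto intro: has_sum_add)

lemma has_sum_operator_nth:
  fixes f :: "'i \<Rightarrow> 'n::finite operator"
  shows "(f has_sum S) A \<Longrightarrow> ((\<lambda>i. f i $ p $ q) has_sum S $ p $ q) A"
  by (rule has_sum_bounded_linear[where h = "\<lambda>X. X $ p $ q"])
    (intro bounded_linear_compose[OF bounded_linear_vec_nth bounded_linear_vec_nth])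

lemma has_sum_operatorI:
  fixes f :: "'i \<Rightarrow> 'n::finite operator"
  assumes "\<And>p q. ((\<lambda>i. f i $ p $ q) has_sum S $ p $ q) A"
  shows "(f has_sum S) A"
  unfolding has_sum_def
  using assms by (intro vec_tendstoI) (simp add: has_sum_def)

text \<open>Each entry is a finite combination of products of one entry from either side, which
  reduces the claim to scalar families.\<close>

lemma has_sum_tensor_map:
  fixes E :: "('i, 'a::finite, 'c::finite) family" and F :: "('j, 'b::finite, 'd::finite) family"
  assumes E: "\<And>X. ((\<lambda>i. E i X) has_sum S X) I" and F: "\<And>X. ((\<lambda>j. F j X) has_sum T X) J"
  shows "((\<lambda>(i, j). tensor_map (E i) (F j) X) has_sum tensor_map S T X) (I \<times> J)"
proof (rule has_sum_operatorI)
  fix p q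
  have "((\<lambda>x. \<Sum>i\<in>UNIV. \<Sum>j\<in>UNIV. \<Sum>k\<in>UNIV. \<Sum>l\<in>UNIV. X $ (i, k) $ (j, l) *
       (case x of (r, s) \<Rightarrow> E r (matrix_unit i j) $ fst p $ fst q * F s (matrix_unit k l) $ snd p $ snd q))
     has_sum (\<Sum>i\<in>UNIV. \<Sum>j\<in>UNIV. \<Sum>k\<in>UNIV. \<Sum>l\<in>UNIV. X $ (i, k) $ (j, l) *
       (S (matrix_unit i j) $ fst p $ fst q * T (matrix_unit k l) $ snd p $ snd q))) (I \<times> J)"
    by (intro has_sum_sum has_sum_cmult_right has_sum_product has_sum_operator_nth E F)
  then show "((\<lambda>x. (case x of (i, j) \<Rightarrow> tensor_map (E i) (F j) X) $ p $ q) has_sum tensor_map S T X $ p $ q) (I \<times> J)"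
    by (simp add: tensor_map_def case_prod_beta)
qed

lemma trace_preserving_tensor_map:
  fixes S :: "('a::finite, 'c::finite) superop" and T :: "('b::finite, 'd::finite) superop"
  assumes "trace_preserving S" "trace_preserving T"
  shows "trace_preserving (tensor_map S T)"
  unfolding trace_preserving_def
proof (intro conjI allI clinear_tensor_map)
  fix X :: "('a \<times> 'b) operator"
  have "trace (tensor_map S T X) = (\<Sum>i\<in>UNIV. \<Sum>j\<in>UNIV. \<Sum>k\<in>UNIV. \<Sum>l\<in>UNIV.
      X $ (i, k) $ (j, l) * (trace (S (matrix_unit i j)) * trace (T (matrix_unit k l))))"
    by (simp add: tensor_map_def trace_sum trace_cscale trace_tensor_op)
  also have "\<dots> = (\<Sum>i\<in>UNIV. \<Sum>j\<in>UNIV. \<Sum>k\<in>UNIV. \<Sum>l\<in>UNIV.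
      if l = k then if j = i then X $ (i, k) $ (j, l) else 0 else 0)"
    using assms by (intro sum.cong refl) (auto simp: trace_preserving_def trace_matrix_unit)
  also have "\<dots> = (\<Sum>i\<in>UNIV. \<Sum>j\<in>UNIV. if j = i then \<Sum>k\<in>UNIV. X $ (i, k) $ (j, k) else 0)"
    by (intro sum.cong refl) simp
  also have "\<dots> = trace X"
    by (simp add: trace_def sum_UNIV_pair)
  finally show "trace (tensor_map S T X) = trace X" .
qed

lemma coarse_graining_refl: "coarse_graining E E"
  unfolding coarse_graining_def by (intro exI[of _ "\<lambda>i. i"]) (auto intro: has_sum_finiteI)

lemma instrument_trivial: "instrument (\<lambda>i :: nat. if i = 0 then (\<lambda>X :: 'n::finite operator. X) else (\<lambda>X. 0))"
  unfolding instrument_def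
proof (intro conjI allI exI)
  show "completely_positive (if i = 0 then (\<lambda>X :: 'n operator. X) else (\<lambda>X. 0))" for i :: nat
    by (simp add: cp_id cp_null)
  show "((\<lambda>i :: nat. (if i = 0 then (\<lambda>X. X) else (\<lambda>X. 0)) X) has_sum X) UNIV" for X :: "'n operator"
    by (rule has_sum_finite_neutralI[of "{0}"]) auto
  show "trace_preserving (\<lambda>X :: 'n operator. X)"
    by (simp add: trace_preserving_def clinear_id)
qed

lemma cptp_id: "cptp (\<lambda>X. X)"
  by (simp add: cptp_def cp_id trace_preserving_def clinear_id)

lemma one_way_localI:
  "instrument E \<Longrightarrow> (\<And>i. cptp (F i)) \<Longrightarrow> one_way_local (\<lambda>i. tensor_map (E i) (F i))"
  "(\<And>i. cptp (E i)) \<Longrightarrow> instrument F \<Longrightarrow> one_way_local (\<lambda>i. tensor_map (E i) (F i))"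
  unfolding one_way_local_def one_way_local_A_def one_way_local_B_def by blast+

text \<open>A round in which both parties do nothing. It prolongs a protocol of finitely many rounds
  to the infinite sequence that \<open>LOCC_instrument\<close> asks for.\<close>

lemma LOCC_linked_refl: "LOCC_linked E E"
  unfolding LOCC_linked_def
proof (intro exI conjI allI)
  let ?J = "\<lambda>i :: nat. tensor_map (if i = 0 then (\<lambda>X :: 'a operator. X) else (\<lambda>X. 0)) (\<lambda>X :: 'b operator. X)"
  show "one_way_local ?J"
    by (rule one_way_localI(1)[OF instrument_trivial cptp_id])
  have J: "?J i = (if i = 0 then (\<lambda>X. X) else (\<lambda>X. 0))" for i
    by (simp add: tensor_map_id tensor_map_null)
  have "((\<lambda>(j, j'). (?J j' \<circ> E j) X) has_sum E k X) {i. fst i = k}" for k X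
    by (rule has_sum_finite_neutralI[of "{(k, 0)}"]) (auto simp: J split: if_splits)
  then show "coarse_graining (\<lambda>(j, j'). ?J j' \<circ> E j) E"
    unfolding coarse_graining_def by (intro exI[of _ fst]) (simp add: case_prod_unfold)
qed

text \<open>One party measures in the first round, the other in the second, whatever the first
  outcome was. From then on the sequence is constant, so convergence is trivial.
  \<open>prod_decode\<close> turns pairs of outcomes into the single label used for LOCC.\<close>

lemma LO_LOCC_instrument:
  fixes E :: "(nat, 'a::finite, 'a) family" and F :: "(nat, 'b::finite, 'b) family"
  assumes E: "instrument E" and F: "instrument F"
  shows "LOCC_instrument (\<lambda>i. tensor_map (E (fst (prod_decode i))) (F (snd (prod_decode i))))"
    (is "LOCC_instrument ?I")
proof -
  define J1 where "J1 = (\<lambda>i. tensor_map (E i) (\<lambda>X :: 'b operator. X))"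
  define J where "J n = (if n = 1 then J1 else ?I)" for n :: nat
  note cl = cp_clinear[OF instrument_cp[OF E]] cp_clinear[OF instrument_cp[OF F]]
  obtain S T where S: "\<And>X. ((\<lambda>i. E i X) has_sum S X) UNIV" "trace_preserving S"
    and T: "\<And>X. ((\<lambda>i. F i X) has_sum T X) UNIV" "trace_preserving T"
    using E F unfolding instrument_def by blast
  have "((\<lambda>i. ?I i X) has_sum tensor_map S T X) UNIV" for X
    using has_sum_tensor_map[OF S(1) T(1), where X = X]
      has_sum_reindex_bij_betw[OF bij_prod_decode, of "\<lambda>(i, j). tensor_map (E i) (F j) X"]
    by (simp add: case_prod_beta)
  then have inst: "instrument ?I"
    unfolding instrument_def
    using trace_preserving_tensor_map[OF S(2) T(2)] cp_tensor_map[OF instrument_cp[OF E] instrument_cp[OF F]]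
    by blast
  have "one_way_local J1"
    unfolding J1_def by (rule one_way_localI(1)[OF E cptp_id])
  then have R1: "LOCC_round 1 J1"
    by (rule LOCC_round.one) (rule coarse_graining_refl)
  have link: "LOCC_linked ?I J1"
    unfolding LOCC_linked_def
  proof (intro exI conjI allI)
    let ?J = "\<lambda>j'. tensor_map (\<lambda>X :: 'a operator. X) (F j')"
    show "one_way_local ?J"
      by (rule one_way_localI(2)[OF cptp_id F])
    have "{i. prod_encode i = k} = {prod_decode k}" for k
      by auto
    moreover have "?J j' \<circ> J1 j = tensor_map (E j) (F j')" for j j'
      by (simp add: J1_def tensor_map_compose clinear_id cl) (simp add: o_def)
    ultimately have "((\<lambda>(j, j'). (?J j' \<circ> J1 j) X) has_sum ?I k X) {i. prod_encode i = k}" for k X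
      by (auto intro!: has_sum_finiteI simp: case_prod_beta)
    then show "coarse_graining (\<lambda>(j, j'). ?J j' \<circ> J1 j) ?I"
      unfolding coarse_graining_def by (intro exI[of _ prod_encode]) (simp add: case_prod_unfold)
  qed
  have links: "LOCC_linked (J n) (J (n - 1))" if "n \<ge> 2" for n
    using that link LOCC_linked_refl[of ?I] by (simp add: J_def)
  have "LOCC_round n (J n)" if "n \<ge> 1" for n
    using that
  proof (induction n rule: dec_induct)
    case base
    show ?case using R1 by (simp add: J_def)
  next
    case (step n)
    then show ?case
      using LOCC_round.step[OF step(3)] links[of "Suc n"] by simp
  qed
  moreover have "instruments_converge J ?I"
  proof -
    have "(\<Sum>i. ennreal (onorm (\<lambda>X. J n i X - ?I i X))) = 0" if "n \<ge> 2" for n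
      using that by (simp add: J_def onorm_zero)
    then show ?thesis
      unfolding instruments_converge_def
      by (intro tendsto_eventually) (auto simp: eventually_sequentially)
  qed
  ultimately show ?thesis
    unfolding LOCC_instrument_def using inst links coarse_graining_refl by blast
qed

lemma LO_star_subset_LOCC_star: "LO_star \<subseteq> LOCC_star"
proof
  fix G :: "('a \<times> 'b, 'a \<times> 'b) superop"
  assume "G \<in> LO_star"
  then obtain H \<beta> where H: "H \<in> LO_instruments" and \<beta>: "\<And>i. \<beta> i \<in> {-1..1::real}"
    and GH: "\<And>X. ((\<lambda>i. \<beta> i *\<^sub>R H i X) has_sum G X) UNIV"
    unfolding LO_star_def Qstar_def by blast
  obtain E F where EF: "instrument E" "instrument F" and "H = (\<lambda>(i, j). tensor_map (E i) (F j))"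
    using H unfolding LO_instruments_def by blast
  then have G: "((\<lambda>i. \<beta> i *\<^sub>R (case i of (i, j) \<Rightarrow> tensor_map (E i) (F j)) X) has_sum G X) UNIV" for X
    using GH by simp
  have "((\<lambda>i. \<beta> (prod_decode i) *\<^sub>R tensor_map (E (fst (prod_decode i))) (F (snd (prod_decode i))) X) has_sum G X) UNIV" for X
    using G[of X] has_sum_reindex_bij_betw[OF bij_prod_decode,
        of "\<lambda>i. \<beta> i *\<^sub>R (case i of (i, j) \<Rightarrow> tensor_map (E i) (F j)) X"]
    by (simp add: case_prod_beta)
  then show "G \<in> LOCC_star"
    unfolding LOCC_star_def Qstar_def
    using LO_LOCC_instrument[OF EF] \<beta>
    by (intro CollectI bexI[rotated] exI[of _ "\<lambda>i. \<beta> (prod_decode i)"] conjI allI) blast+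
qed

lemma qp_extent_antimono: "S \<subseteq> S' \<Longrightarrow> qp_extent S' E \<le> qp_extent S E"
  unfolding qp_extent_def by (intro Inf_superset_mono) blast

section \<open>The local decomposition\<close>

lemma qp_extent_le_sum:
  fixes a :: "'i \<Rightarrow> real"
  assumes "finite I" "I \<noteq> {}" "\<And>i. i \<in> I \<Longrightarrow> F i \<in> S" "E = (\<lambda>X. \<Sum>i\<in>I. a i *\<^sub>R F i X)"
  shows "qp_extent S E \<le> ereal (\<Sum>i\<in>I. \<bar>a i\<bar>)"
proof -
  obtain h where h: "bij_betw h {..<card I} I"
    using ex_bij_betw_nat_finite[OF assms(1)] by (auto simp: lessThan_atLeast0)
  have "1 \<le> card I"
    using assms(1,2) by (simp add: Suc_le_eq card_gt_0_iff)
  moreover have "\<forall>i<card I. F (h i) \<in> S"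
    using assms(3) bij_betwE[OF h] by auto
  moreover have "E = (\<lambda>X. \<Sum>i<card I. a (h i) *\<^sub>R F (h i) X)"
    unfolding assms(4) sum.reindex_bij_betw[OF h, of "\<lambda>i. a i *\<^sub>R F i _"] ..
  ultimately show ?thesis
    unfolding qp_extent_def sum.reindex_bij_betw[OF h, of "\<lambda>i. \<bar>a i\<bar>", symmetric]
    by (intro Inf_lower) (intro CollectI exI[of _ "card I"] exI[of _ "\<lambda>i. a (h i)"] exI[of _ "\<lambda>i. F (h i)"], simp)
qed

section \<open>Real and imaginary parts of the cross terms\<close>

lemma matrix_cscale_left: "cscale c A ** B = cscale c (A ** B)"
  and matrix_cscale_right: "A ** cscale c B = cscale c (A ** B)"
  by (simp_all add: vec_eq_iff matrix_mult_nth sum_distrib_left mult_ac)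

lemma dagger_cscale: "dagger (cscale c A) = cscale (cnj c) (dagger A)"
  by (simp add: vec_eq_iff)

text \<open>The real part of the map sending \<open>X\<close> to \<open>V ** X ** dagger W\<close>.
  Replacing \<open>W\<close> by \<open>cscale \<i> W\<close> gives the imaginary part, so one
  construction serves both.\<close>

definition cross_map :: "'n::finite operator \<Rightarrow> 'n operator \<Rightarrow> ('n, 'n) superop" where
  "cross_map V W = (\<lambda>X. (1/2) *\<^sub>R (V ** X ** dagger W + W ** X ** dagger V))"

lemma clinear_cross_map: "clinear (cross_map V W)"
  unfolding cross_map_def clinear_iff
  by (simp add: clinear_add[OF clinear_sandwich] clinear_cscale[OF clinear_sandwich])
    (simp add: vec_eq_iff scaleR_eq_cscale algebra_simps)

text \<open>The cross terms of \<open>V X V\<^sup>\<dagger>\<close>, \<open>W X W\<^sup>\<dagger>\<close> are the difference of the two outcomes of the instrument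
  with Kraus operators \<open>(V + W)/2\<close> and \<open>(V - W)/2\<close>.\<close>

definition cross_instrument :: "'n::finite operator \<Rightarrow> 'n operator \<Rightarrow> (nat, 'n, 'n) family" where
  "cross_instrument V W i = (if i = 0 then (\<lambda>X. ((1/2) *\<^sub>R (V + W)) ** X ** dagger ((1/2) *\<^sub>R (V + W)))
     else if i = 1 then (\<lambda>X. ((1/2) *\<^sub>R (V - W)) ** X ** dagger ((1/2) *\<^sub>R (V - W))) else (\<lambda>X. 0))"

lemma cross_instrument_null: "i \<noteq> 0 \<Longrightarrow> i \<noteq> 1 \<Longrightarrow> cross_instrument V W i = (\<lambda>X. 0)"
  by (simp add: cross_instrument_def)

lemma cross_sum:
  "cross_instrument V W 0 X + cross_instrument V W 1 X = (1/2) *\<^sub>R (V ** X ** dagger V + W ** X ** dagger W)"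
  and cross_diff:
  "cross_instrument V W 0 X - cross_instrument V W 1 X = cross_map V W X"
proof -
  have *: "dagger (A + B) = dagger A + dagger B" "dagger (A - B) = dagger A - dagger B"
    for A B :: "'a operator"
    by (simp_all add: vec_eq_iff)
  have "A ** (B - C) = A ** B - A ** C" "(B - C) ** A = B ** A - C ** A"
    "(B + C) ** A = B ** A + C ** A" for A B C :: "'a operator"
    by (simp_all add: vec_eq_iff matrix_mult_nth algebra_simps sum_subtractf sum.distrib)
  note * = * this dagger_cscale matrix_add_ldistrib matrix_cscale_left matrix_cscale_right
  show "cross_instrument V W 0 X + cross_instrument V W 1 X = (1/2) *\<^sub>R (V ** X ** dagger V + W ** X ** dagger W)"
    "cross_instrument V W 0 X - cross_instrument V W 1 X = cross_map V W X"
    unfolding cross_instrument_def cross_map_def scaleR_eq_cscale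
    by (simp_all add: * vec_eq_iff, simp_all add: field_simps)
qed

text \<open>In the sum of the two outcomes the cross terms cancel, leaving the average of two
  unitary channels.\<close>

lemma instrument_cross_instrument:
  fixes V W :: "'n::finite operator"
  assumes "unitary_op V" "unitary_op W"
  shows "instrument (cross_instrument V W)"
  unfolding instrument_def
proof (intro conjI allI exI)
  let ?T = "\<lambda>X. (1/2) *\<^sub>R (V ** X ** dagger V + W ** X ** dagger W)"
  show "completely_positive (cross_instrument V W i)" for i
    by (simp add: cross_instrument_def cp_kraus cp_null)
  show "((\<lambda>i. cross_instrument V W i X) has_sum ?T X) UNIV" for X
    by (rule has_sum_finite_neutralI[of "{0, 1}"])
      (auto simp: cross_sum[symmetric], simp add: cross_instrument_def)
  show "trace_preserving ?T"
    using trace_preserving_unitary_channel[OF assms(1)] trace_preserving_unitary_channel[OF assms(2)]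
    unfolding trace_preserving_def unitary_channel_def clinear_iff
    by (simp add: trace_add scaleR_eq_cscale trace_cscale cscale_add_right cscale_cscale mult.commute algebra_simps)
qed

lemma tensor_cross_map_in_LO_star:
  assumes "unitary_op V" "unitary_op W" "unitary_op V'" "unitary_op W'"
  shows "tensor_map (cross_map V W) (cross_map V' W') \<in> LO_star"
proof -
  let ?E = "cross_instrument V W" and ?F = "cross_instrument V' W'"
  \<comment> \<open>The local sign of an outcome: the difference on each side becomes a product of
    signs on the joint outcomes. Labels from 2 on carry the zero map, so their sign is arbitrary
    within [-1, 1].\<close>
  define sg :: "nat \<Rightarrow> real" where "sg i = (if i = 0 then 1 else -1)" for i
  have bil: "(\<Sum>(i, j)\<in>{0, 1} \<times> {0, 1}. (sg i * sg j) *\<^sub>R tensor_map (?E i) (?F j) X)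
      = tensor_map (cross_map V W) (cross_map V' W') X" for X
    unfolding cross_diff[symmetric, abs_def] tensor_map_def
    by (simp add: sum_Times sg_def scaleR_eq_cscale cscale_sum)
      (simp add: sum.distrib[symmetric] sum_negf[symmetric] sum_subtractf[symmetric] vec_eq_iff algebra_simps)
  have "((\<lambda>i. (sg (fst i) * sg (snd i)) *\<^sub>R (case i of (i, j) \<Rightarrow> tensor_map (?E i) (?F j)) X)
      has_sum tensor_map (cross_map V W) (cross_map V' W') X) UNIV" for X
  proof (rule has_sum_finite_neutralI[of "{0, 1} \<times> {0, 1}"])
    fix x :: "nat \<times> nat" assume "x \<in> UNIV - {0, 1} \<times> {0, 1}"
    then show "(sg (fst x) * sg (snd x)) *\<^sub>R (case x of (i, j) \<Rightarrow> tensor_map (?E i) (?F j)) X = 0"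
      by (cases x) (auto simp: cross_instrument_null tensor_map_null)
  qed (simp_all add: bil[symmetric] case_prod_beta)
  moreover have "sg (fst i) * sg (snd i) \<in> {-1..1}" for i
    by (simp add: sg_def)
  moreover have "(\<lambda>(i, j). tensor_map (?E i) (?F j)) \<in> LO_instruments"
    unfolding LO_instruments_def
    using instrument_cross_instrument[OF assms(1,2)] instrument_cross_instrument[OF assms(3,4)] by blast
  ultimately show ?thesis
    unfolding LO_star_def Qstar_def
    by (intro CollectI bexI[rotated] exI[of _ "\<lambda>i. sg (fst i) * sg (snd i)"] conjI allI)
qed

lemma unitary_op_cscale_i: "unitary_op W \<Longrightarrow> unitary_op (cscale \<i> W)"
  by (simp add: unitary_op_def dagger_cscale matrix_cscale_left matrix_cscale_right cscale_cscale)
    (simp add: vec_eq_iff)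

text \<open>Writing \<open>A = V X W\<^sup>\<dagger>\<close>, \<open>A' = W X V\<^sup>\<dagger>\<close> and \<open>B\<close>, \<open>B'\<close> likewise, the left side is
  \<open>((A + A') \<otimes> (B + B') + (A - A') \<otimes> (B - B'))/4\<close>.\<close>

lemma cross_map_product:
  "tensor_op (cross_map V W X) (cross_map V' W' Y)
     - tensor_op (cross_map V (cscale \<i> W) X) (cross_map V' (cscale \<i> W') Y)
   = (1/2) *\<^sub>R (tensor_op (V ** X ** dagger W) (V' ** Y ** dagger W')
      + tensor_op (W ** X ** dagger V) (W' ** Y ** dagger V'))"
  unfolding cross_map_def dagger_cscale matrix_cscale_left matrix_cscale_right
  by (simp add: vec_eq_iff scaleR_eq_cscale algebra_simps)

text \<open>The map with the single Kraus operator \<open>V\<close> preserves Hermiticity and so has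
  no imaginary part. Hence diagonal pairs cost \<open>(u j)\<^sup>2\<close> and not twice
  that.\<close>

lemma cross_map_self_i: "cross_map V (cscale \<i> V) X = 0"
  by (simp add: cross_map_def dagger_cscale matrix_cscale_left matrix_cscale_right) (simp add: vec_eq_iff)

section \<open>The decomposition of the channel and its cost\<close>

context
  fixes U :: "('a::finite \<times> 'b::finite) operator"
    and m :: nat and u :: "nat \<Rightarrow> real"
    and L :: "nat \<Rightarrow> 'a operator" and R :: "nat \<Rightarrow> 'b operator"
  assumes schmidt: "operator_schmidt_decomp U m u L R"
    and L: "\<forall>j<m. unitary_op (L j)" and R: "\<forall>j<m. unitary_op (R j)"
begin

lemma unitary_channel_decomposition:
  "unitary_channel U = (\<lambda>X. \<Sum>j<m. \<Sum>k<m.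
     (u j * u k) *\<^sub>R tensor_map (cross_map (L j) (L k)) (cross_map (R j) (R k)) X
     - (if j = k then 0 else u j * u k) *\<^sub>R
       tensor_map (cross_map (L j) (cscale \<i> (L k))) (cross_map (R j) (cscale \<i> (R k))) X)"
proof (rule clinear_eqI_tensor)
  show "clinear (unitary_channel U)"
    unfolding unitary_channel_def by (rule clinear_sandwich)
  have "clinear (\<lambda>X. r *\<^sub>R F X - s *\<^sub>R G X)" if "clinear F" "clinear G" for r s and F G :: "('a \<times> 'b, 'a \<times> 'b) superop"
    using that by (simp add: clinear_iff scaleR_eq_cscale vec_eq_iff algebra_simps)
  then show "clinear (\<lambda>X. \<Sum>j<m. \<Sum>k<m.
     (u j * u k) *\<^sub>R tensor_map (cross_map (L j) (L k)) (cross_map (R j) (R k)) X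
     - (if j = k then 0 else u j * u k) *\<^sub>R
       tensor_map (cross_map (L j) (cscale \<i> (L k))) (cross_map (R j) (cscale \<i> (R k))) X)"
    by (intro clinear_sum_fun) (simp add: clinear_tensor_map)
next
  fix X Y
  define t where "t j k = tensor_op (L j ** X ** dagger (L k)) (R j ** Y ** dagger (R k))" for j k
  have "(u j * u k) *\<^sub>R tensor_op (cross_map (L j) (L k) X) (cross_map (R j) (R k) Y)
     - (if j = k then 0 else u j * u k) *\<^sub>R
       tensor_op (cross_map (L j) (cscale \<i> (L k)) X) (cross_map (R j) (cscale \<i> (R k)) Y)
     = (u j * u k / 2) *\<^sub>R (t j k + t k j)" for j k
  proof -
    \<comment> \<open>The coefficient 0 on the diagonal multiplies a vanishing map, so it can be
      restored to \<open>u j * u k\<close> and the product identity applied uniformly.\<close>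
    have e: "(if j = k then 0 else u j * u k) *\<^sub>R
       tensor_op (cross_map (L j) (cscale \<i> (L k)) X) (cross_map (R j) (cscale \<i> (R k)) Y)
      = (u j * u k) *\<^sub>R
       tensor_op (cross_map (L j) (cscale \<i> (L k)) X) (cross_map (R j) (cscale \<i> (R k)) Y)"
      by (auto simp: cross_map_self_i vec_eq_iff)
    show ?thesis
      unfolding e scaleR_diff_right[symmetric] cross_map_product t_def by simp
  qed
  then have "(\<Sum>j<m. \<Sum>k<m. (u j * u k) *\<^sub>R tensor_op (cross_map (L j) (L k) X) (cross_map (R j) (R k) Y)
     - (if j = k then 0 else u j * u k) *\<^sub>R
       tensor_op (cross_map (L j) (cscale \<i> (L k)) X) (cross_map (R j) (cscale \<i> (R k)) Y))
     = (\<Sum>j<m. \<Sum>k<m. (u j * u k / 2) *\<^sub>R t j k) + (\<Sum>j<m. \<Sum>k<m. (u j * u k / 2) *\<^sub>R t k j)"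
    by (simp add: scaleR_add_right sum.distrib)
  \<comment> \<open>The adjoint terms are the original ones with \<open>j\<close> and
    \<open>k\<close> exchanged, and the coefficients are symmetric.\<close>
  also have "(\<Sum>j<m. \<Sum>k<m. (u j * u k / 2) *\<^sub>R t k j) = (\<Sum>j<m. \<Sum>k<m. (u j * u k / 2) *\<^sub>R t j k)"
    by (subst sum.swap) (simp add: mult.commute)
  also have "(\<Sum>j<m. \<Sum>k<m. (u j * u k / 2) *\<^sub>R t j k) + (\<Sum>j<m. \<Sum>k<m. (u j * u k / 2) *\<^sub>R t j k)
      = (\<Sum>j<m. \<Sum>k<m. (u j * u k) *\<^sub>R t j k)"
    by (simp add: sum.distrib[symmetric] scaleR_add_left[symmetric])
  also have "\<dots> = unitary_channel U (tensor_op X Y)"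
  proof -
    have U: "U = (\<Sum>j<m. u j *\<^sub>R tensor_op (L j) (R j))"
      using schmidt by (simp add: operator_schmidt_decomp_def)
    have ml: "(\<Sum>j\<in>J. r j *\<^sub>R A j) ** C = (\<Sum>j\<in>J. r j *\<^sub>R (A j ** C))"
      and mr: "C ** (\<Sum>j\<in>J. r j *\<^sub>R A j) = (\<Sum>j\<in>J. r j *\<^sub>R (C ** A j))"
      and dg: "dagger (\<Sum>j\<in>J. r j *\<^sub>R A j) = (\<Sum>j\<in>J. r j *\<^sub>R dagger (A j))"
      for J r and C and A :: "nat \<Rightarrow> ('a \<times> 'b) operator"
      by (simp_all add: vec_eq_iff matrix_mult_nth scaleR_eq_cscale sum_distrib_left sum_distrib_right
          mult_ac sum.swap[of _ J])
    have "unitary_channel U (tensor_op X Y) = (\<Sum>k<m. u k *\<^sub>R (\<Sum>j<m. u j *\<^sub>R t j k))"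
      unfolding unitary_channel_def U ml dg mr
      by (simp add: t_def dagger_tensor_op tensor_op_mult)
    also have "\<dots> = (\<Sum>k<m. \<Sum>j<m. (u j * u k) *\<^sub>R t j k)"
      by (simp add: scaleR_sum_right mult.commute)
    finally show ?thesis by (subst sum.swap) simp
  qed
  finally show "unitary_channel U (tensor_op X Y) = (\<Sum>j<m. \<Sum>k<m.
     (u j * u k) *\<^sub>R tensor_map (cross_map (L j) (L k)) (cross_map (R j) (R k)) (tensor_op X Y)
     - (if j = k then 0 else u j * u k) *\<^sub>R
       tensor_map (cross_map (L j) (cscale \<i> (L k))) (cross_map (R j) (cscale \<i> (R k))) (tensor_op X Y))"
    by (simp add: tensor_map_tensor_op clinear_cross_map)
qed

lemma qp_extent_LO_star_le:
  assumes U: "unitary_op U"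
  shows "qp_extent LO_star (unitary_channel U) \<le> ereal (2 * (\<Sum>j<m. u j)\<^sup>2 - 1)"
proof -
  \<comment> \<open>The boolean selects the product of real parts (\<open>True\<close>) or of
    imaginary parts (\<open>False\<close>).\<close>
  define I where "I = {..<m} \<times> {..<m} \<times> (UNIV :: bool set)"
  define a where "a = (\<lambda>(j, k, b). if b then u j * u k else if j = k then 0 else - (u j * u k))"
  define F where "F = (\<lambda>(j, k, b). if b then tensor_map (cross_map (L j) (L k)) (cross_map (R j) (R k))
     else tensor_map (cross_map (L j) (cscale \<i> (L k))) (cross_map (R j) (cscale \<i> (R k))))"
  have sq: "(\<Sum>j<m. (u j)\<^sup>2) = 1"
    by (rule schmidt_coeffs_square_sum[OF schmidt U])
  \<comment> \<open>A sum of squares equal to 1 has a term, so the decomposition is nonempty, as the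
    extent requires.\<close>
  then have m: "m > 0" by (cases m) auto
  have u: "u j > 0" if "j < m" for j
    using schmidt that by (simp add: operator_schmidt_decomp_def)
  have eq: "unitary_channel U = (\<lambda>X. \<Sum>i\<in>I. a i *\<^sub>R F i X)"
    unfolding unitary_channel_decomposition I_def a_def F_def
    by (rule ext) (auto simp: sum_Times UNIV_bool intro!: sum.cong)
  have "qp_extent LO_star (unitary_channel U) \<le> ereal (\<Sum>i\<in>I. \<bar>a i\<bar>)"
  proof (rule qp_extent_le_sum[OF _ _ _ eq])
    show "finite I" "I \<noteq> {}"
      using m by (auto simp: I_def)
    show "F i \<in> LO_star" if "i \<in> I" for i
      using that L R by (auto simp: I_def F_def intro!: tensor_cross_map_in_LO_star unitary_op_cscale_i)
  qed
  also have "(\<Sum>i\<in>I. \<bar>a i\<bar>) = (\<Sum>j<m. \<Sum>k<m. 2 * (u j * u k) - (if k = j then (u j)\<^sup>2 else 0))"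
    unfolding I_def sum_Times
  proof (intro sum.cong refl)
    fix j k assume "j \<in> {..<m}" "k \<in> {..<m}"
    then show "(\<Sum>b\<in>UNIV. \<bar>a (j, k, b)\<bar>) = 2 * (u j * u k) - (if k = j then (u j)\<^sup>2 else 0)"
      using u[of j] u[of k] by (simp add: UNIV_bool a_def power2_eq_square abs_mult)
  qed
  also have "\<dots> = 2 * (\<Sum>j<m. u j)\<^sup>2 - 1"
    using sq by (simp add: sum_subtractf sum_distrib_left[symmetric] sum_distrib_right[symmetric] power2_eq_square)
  finally show ?thesis .
qed

end

theorem theorem5p44:
  fixes U :: "('a::finite \<times> 'b::finite) operator"
    and m :: nat and u :: "nat \<Rightarrow> real"
    and L :: "nat \<Rightarrow> 'a operator" and R :: "nat \<Rightarrow> 'b operator"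
  assumes "unitary_op U"
    and "operator_schmidt_decomp U m u L R"
    and "\<forall>j<m. unitary_op (L j)"
    and "\<forall>j<m. unitary_op (R j)"
  shows "qp_extent LOCC_star (unitary_channel U) = qp_extent LO_star (unitary_channel U) \<and>
    qp_extent LO_star (unitary_channel U) = ereal (2 * (\<Sum>j<m. u j)\<^sup>2 - 1)"
  \<comment> \<open>Lower bound for LOCC, monotonicity under inclusion and upper bound for LO close
    a cycle of inequalities.\<close>
  using qp_extent_LOCC_star_ge[OF assms(2,1)] qp_extent_LO_star_le[OF assms(2-4,1)]
    qp_extent_antimono[OF LO_star_subset_LOCC_star, of "unitary_channel U"]
  by auto

end
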